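(* Let $m\ge2$, let $L,E\in\mathbb R^m$ have positive entries, let $C>0$, $Q_r>0$, and let $R>0$ (the unknown load). Let $J:\mathbb R^{m+1}\to\mathbb R$ be a cost function and let $J_z$, $\Phi$, $U$, $L_{\mathrm{eq},m}$, $\varphi_T^\star$ be as in the context. Assume: (A) $J_z$ is continuously differentiable and, for all $\varphi_T>0$, the map $J_z(\cdot,\varphi_T)$ is strictly convex and admits a minimum. Write $\mathcal C^\star(\varphi_T)=\operatorname{argmin}_{\mathcal C}J_z(\mathcal C,\varphi_T)$ for $\varphi_T>0$ and $\mathcal C^\star=\mathcal C^\star(\varphi_T^\star)$, and define $h:\mathbb R^{m-1}\times\mathbb R\to\mathbb R^{m-1}$ and $W:\mathbb R^{m-1}\to\mathbb R$ by $$h(\tilde{\mathcal C},\tilde\varphi_T)=\nabla_{\mathcal C}J_z(\tilde{\mathcal C}+\mathcal C^\star,\tilde\varphi_T+\varphi_T^\star)-\nabla_{\mathcal C}J_z(\tilde{\mathcal C}+\mathcal C^\star,\varphi_T^\star),\qquad W(\tilde{\mathcal C})=J_z(\tilde{\mathcal C}+\mathcal C^\star,\varphi_T^\star)-J_z(\mathcal C^\star,\varphi_T^\star).$$ Assume further: (F1) There exist two strictly increasing functions $G_1,G_2:[0,\infty)\to\mathbb R$, null and differentiable at the origin, such that $\|h(\tilde{\mathcal C},\tilde\varphi_T)\|\le G_1(|\tilde\varphi_T|)+G_2(|\tilde\varphi_T|)\,\|\tilde{\mathcal C}\|$ for all $(\tilde{\mathcal C},\tilde\varphi_T)\in\mathbb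 R^{m-1}\times\mathbb R$. (F2) There exist positive constants $c$ and $k$ such that $\|\tilde{\mathcal C}\|>c$ implies $\|\nabla W(\tilde{\mathcal C})\|\,\|\tilde{\mathcal C}\|\le k\,W(\tilde{\mathcal C})$. Let $K_\lambda=K_\lambda^\top\in\mathbb R^{(m-1)\times(m-1)}$ be positive definite, $k_d>0$, $k_i>0$. Then the control law (which does not depend on $R$) $$\dot\xi=k_i\frac{Q-Q_r}{C},\qquad \mu=-\frac1{E_{\mathrm{eq}}}\left(k_d\frac{\varphi_T}{L_{\mathrm{eq},m}}+k_d\xi+L_{\mathrm{eq},m}k_i\frac{Q-Q_r}{C}\right),$$ $$\lambda=-\mathrm{diag}\{\tilde E\}^{-1}K_\lambda\nabla_{\mathcal C}J_z(\mathcal C,\varphi_T),\qquad d=U[\lambda^\top,\ \mu]^\top,$$ where $[\mathcal C^\top,\varphi_T,Q]^\top=\Phi^{-1}[\varphi^\top,Q]^\top$, solves the following control problem for the system $$\dot\varphi_k=-\frac QC+E_kd_k\ (k=1,\dots,m),\qquad \dot Q=\sum_{k=1}^m\frac{\varphi_k}{L_k}-\frac Q{RC}:$$ the resulting closed-loop system, with state $(\varphi,Q,\xi)\in\mathbb R^{m}\times\mathbb R\times\mathbb R$, admits a unique equilibrium point, this equilibrium is globally asymptotically stable, and its $(\varphi,Q)$-component is $$x^\star=\operatorname*{argmin}_{(\varphi,Q)}J(\varphi,Q)\quad\text{subject to}\quad Q=Q_r,\ (\dot\varphi,\dot Q)=\mathbf 0.$$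
   Context: Notation: $\mathbf 1_n,\mathbf 0_n$ are the column vectors of size $n$ with all entries $1$, respectively $0$; $\mathbf I_n$ is the identity matrix; $\mathrm{diag}\{\cdot\}$ builds a diagonal matrix from its vector argument; $\nabla$ is the gradient written as a column vector, $\nabla_{\mathcal C}$ the partial gradient with respect to the first argument $\mathcal C\in\mathbb R^{m-1}$. No bounds on $d\in\mathbb R^m$ are imposed. The constraint $(\dot\varphi,\dot Q)=\mathbf 0$ in the optimization problem means that $(\varphi,Q)$ is an admissible equilibrium of the open-loop system, i.e. the right-hand side of the system vanishes for some $d\in\mathbb R^m$. For $k\in\{1,\dots,m\}$: $1/L_{\mathrm{eq},k}=\sum_{j=1}^k1/L_j$. The matrix $\Gamma_m^\top\in\mathbb R^{(m-1)\times m}$ is $\Gamma_m^\top=G-[\mathbf 0_{m-1}\ \ \mathbf I_{m-1}]$, where the $k$-th row of $G$ is $G_k=L_{\mathrm{eq},k}[1/L_1,\dots,1/L_k,0,\dots,0]$. Further, $$\Phi^{-1}=\begin{bmatrix}\Gamma_m^\top&\mathbf 0_{m-1}\\ \mathbf 1_m^\top\mathrm{diag}\{L\}^{-1}L_{\mathrm{eq},m}&0\\ \mathbf 0_m^\top&1\end{bmatrix},\qquad U=\mathrm{diag}\{E\}^{-1}\begin{bmatrix}\Gamma_m^\top\\ \mathbf 1_m^\top\mathrm{diag}\{L\}^{-1}L_{\mathrm{eq},m}\end{bmatrix}^{-1}\begin{bmatrix}\mathrm{diag}\{\tilde E\}&\mathbf 0_{m-1}\\ \mathbf 0_{m-1}^\top&E_{\mathrm{eq}}\end{bmatrix},$$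 where $\tilde E\in\mathbb R^{m-1}$ (positive entries) and $E_{\mathrm{eq}}>0$ are chosen parameters; both matrices are invertible. $\Phi$ is the inverse of $\Phi^{-1}$. The transformed cost is $J_z:\mathbb R^{m-1}\times\mathbb R\to\mathbb R$, $J_z(\mathcal C,\varphi_T)=J\big(\Phi[\mathcal C^\top,\varphi_T,Q_r]^\top\big)$, and $\varphi_T^\star=L_{\mathrm{eq},m}Q_r/(RC)$. *)

theory Defs
  imports "HOL-Analysis.Analysis" "HOL-Library.Option_ord"
begin

text \<open>
  Index conventions. Throughout, \<open>'n\<close> is a finite linearly ordered type playing the role of
  \<open>{1, ..., m - 1}\<close>, so that \<open>m \<ge> 2\<close> is automatic. The indices \<open>{1, ..., m}\<close> are the elements of
  \<open>'n option\<close> in the order of \<open>HOL-Library.Option_ord\<close>: \<open>None\<close> is the index \<open>1\<close>, and \<open>Some k\<close> is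
  the index \<open>k + 1\<close>. Hence \<open>j < Some k\<close> expresses that the index \<open>j\<close> is one of \<open>1, ..., k\<close>.

  The type \<open>'p + 1\<close> indexes vectors with one more entry, placed last; \<open>1\<close> is the one-element type.
\<close>

definition vsnoc :: "'a ^ 'p \<Rightarrow> 'a \<Rightarrow> 'a ^ ('p::finite + 1)" where
  "vsnoc v a = (\<chi> i. case i of Inl k \<Rightarrow> v $ k | Inr _ \<Rightarrow> a)"

definition vinit :: "'a ^ ('p::finite + 1) \<Rightarrow> 'a ^ 'p" where
  "vinit v = (\<chi> k. v $ Inl k)"

definition vlast :: "'a ^ ('p::finite + 1) \<Rightarrow> 'a" where
  "vlast v = v $ Inr 1"

definition diag :: "real ^ 'p \<Rightarrow> real ^ 'p ^ 'p" where
  "diag v = (\<chi> i j. if i = j then v $ i else 0)"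

definition grad :: "('a::real_inner \<Rightarrow> real) \<Rightarrow> 'a \<Rightarrow> 'a" where
  "grad f x = (THE D. GDERIV f x :> D)"

definition continuously_differentiable ::
    "('a::real_normed_vector \<Rightarrow> 'b::real_normed_vector) \<Rightarrow> bool" where
  "continuously_differentiable f \<longleftrightarrow>
     (\<exists>f'. (\<forall>x. (f has_derivative blinfun_apply (f' x)) (at x)) \<and> continuous_on UNIV f')"

definition strictly_convex :: "('a::real_vector \<Rightarrow> real) \<Rightarrow> bool" where
  "strictly_convex f \<longleftrightarrow>
     (\<forall>x y t. x \<noteq> y \<longrightarrow> 0 < t \<longrightarrow> t < 1 \<longrightarrow>
        f ((1 - t) *\<^sub>R x + t *\<^sub>R y) < (1 - t) * f x + t * f y)"

definition positive_definite :: "real ^ 'p ^ 'p \<Rightarrow> bool" where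
  "positive_definite K \<longleftrightarrow> (\<forall>v. v \<noteq> 0 \<longrightarrow> v \<bullet> (K *v v) > 0)"

definition solves_on ::
    "('a::real_normed_vector \<Rightarrow> 'a) \<Rightarrow> real set \<Rightarrow> (real \<Rightarrow> 'a) \<Rightarrow> bool" where
  "solves_on F I x \<longleftrightarrow> (\<forall>t\<in>I. (x has_vector_derivative F (x t)) (at t within I))"

text \<open>
  The closed-loop vector field is continuous but need not be locally Lipschitz, so solutions are not
  assumed to be unique. Stability and attractivity are therefore required of every solution, and
  to exclude vacuity, solutions must exist from every initial state and be extendable to
  \<open>[0, \<infinity>)\<close>.
\<close>

definition forward_complete :: "('a::real_normed_vector \<Rightarrow> 'a) \<Rightarrow> bool" where
  "forward_complete F \<longleftrightarrow>
     (\<forall>p. \<exists>x. solves_on F {0..} x \<and> x 0 = p) \<and>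
     (\<forall>T>0. \<forall>x. solves_on F {0..<T} x \<longrightarrow>
        (\<exists>y. solves_on F {0..} y \<and> (\<forall>t\<in>{0..<T}. y t = x t)))"

definition globally_asymptotically_stable :: "('a::real_normed_vector \<Rightarrow> 'a) \<Rightarrow> 'a \<Rightarrow> bool" where
  "globally_asymptotically_stable F p \<longleftrightarrow>
     F p = 0 \<and>
     forward_complete F \<and>
     (\<forall>\<epsilon>>0. \<exists>\<delta>>0. \<forall>x. solves_on F {0..} x \<longrightarrow> dist (x 0) p < \<delta> \<longrightarrow>
        (\<forall>t\<ge>0. dist (x t) p < \<epsilon>)) \<and>
     (\<forall>x. solves_on F {0..} x \<longrightarrow> (x \<longlongrightarrow> p) at_top)"

type_synonym 'i rvec = "(real, 'i) vec"
type_synonym ('i, 'j) rmat = "((real, 'j) vec, 'i) vec"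

text \<open>\<open>L_par L S\<close> is the parallel inductance of the branches in \<open>S\<close>: \<open>L_eq,k\<close> is obtained for
  \<open>S = {..<Some k}\<close> and \<open>L_eq,m\<close> for \<open>S = UNIV\<close>.\<close>

definition L_par :: "'i::finite rvec \<Rightarrow> 'i set \<Rightarrow> real" where
  "L_par L S = 1 / (\<Sum>j\<in>S. 1 / L $ j)"

definition Gmat :: "'n::{finite,linorder} option rvec \<Rightarrow> ('n, 'n option) rmat" where
  "Gmat L = (\<chi> k j. if j < Some k then L_par L {..<Some k} * (1 / L $ j) else 0)"

definition Gamma_T :: "'n::{finite,linorder} option rvec \<Rightarrow> ('n, 'n option) rmat" where
  "Gamma_T L = Gmat L - (\<chi> k j. if j = Some k then 1 else 0)"

text \<open>Matrices are vectors of rows, so \<open>vsnoc\<close> also appends a bottom row to a matrix.\<close>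

definition Gamma_ext :: "'n::{finite,linorder} option rvec \<Rightarrow> ('n + 1, 'n option) rmat" where
  "Gamma_ext L = vsnoc (Gamma_T L) (L_par L UNIV *\<^sub>R (1 v* matrix_inv (diag L)))"

definition Phi_inv ::
    "'n::{finite,linorder} option rvec \<Rightarrow> (('n + 1) + 1, 'n option + 1) rmat" where
  "Phi_inv L = vsnoc (\<chi> r. vsnoc (Gamma_ext L $ r) 0) (vsnoc 0 1)"

definition Phi ::
    "'n::{finite,linorder} option rvec \<Rightarrow> ('n option + 1, ('n + 1) + 1) rmat" where
  "Phi L = matrix_inv (Phi_inv L)"

definition Umat :: "'n::{finite,linorder} option rvec \<Rightarrow> 'n option rvec \<Rightarrow> 'n rvec \<Rightarrow> real
    \<Rightarrow> ('n option, 'n + 1) rmat" where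
  "Umat L E Et Eeq =
     matrix_inv (diag E) ** matrix_inv (Gamma_ext L) **
       vsnoc (\<chi> r. vsnoc (diag Et $ r) 0) (vsnoc 0 Eeq)"

definition Jz :: "(('n::{finite,linorder} option + 1) rvec \<Rightarrow> real) \<Rightarrow> 'n option rvec \<Rightarrow> real
    \<Rightarrow> 'n rvec \<times> real \<Rightarrow> real" where
  "Jz J L Qr = (\<lambda>(\<C>, \<phi>T). J (Phi L *v vsnoc (vsnoc \<C> \<phi>T) Qr))"

definition grad_Jz :: "(('n::{finite,linorder} option + 1) rvec \<Rightarrow> real) \<Rightarrow> 'n option rvec
    \<Rightarrow> real \<Rightarrow> 'n rvec \<Rightarrow> real \<Rightarrow> 'n rvec" where
  "grad_Jz J L Qr \<C> \<phi>T = grad (\<lambda>c. Jz J L Qr (c, \<phi>T)) \<C>"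

definition phiT_star :: "'n::finite option rvec \<Rightarrow> real \<Rightarrow> real \<Rightarrow> real \<Rightarrow> real" where
  "phiT_star L C Qr R = L_par L UNIV * Qr / (R * C)"

definition C_star :: "(('n::{finite,linorder} option + 1) rvec \<Rightarrow> real) \<Rightarrow> 'n option rvec
    \<Rightarrow> real \<Rightarrow> real \<Rightarrow> 'n rvec" where
  "C_star J L Qr \<phi>T = arg_min (\<lambda>\<C>. Jz J L Qr (\<C>, \<phi>T)) (\<lambda>_. True)"

definition h_fun :: "(('n::{finite,linorder} option + 1) rvec \<Rightarrow> real) \<Rightarrow> 'n option rvec
    \<Rightarrow> real \<Rightarrow> real \<Rightarrow> real \<Rightarrow> 'n rvec \<Rightarrow> real \<Rightarrow> 'n rvec" where
  "h_fun J L C Qr R c p =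
     (let ps = phiT_star L C Qr R; cs = C_star J L Qr ps
      in grad_Jz J L Qr (c + cs) (p + ps) - grad_Jz J L Qr (c + cs) ps)"

definition W_fun :: "(('n::{finite,linorder} option + 1) rvec \<Rightarrow> real) \<Rightarrow> 'n option rvec
    \<Rightarrow> real \<Rightarrow> real \<Rightarrow> real \<Rightarrow> 'n rvec \<Rightarrow> real" where
  "W_fun J L C Qr R c =
     (let ps = phiT_star L C Qr R; cs = C_star J L Qr ps
      in Jz J L Qr (c + cs, ps) - Jz J L Qr (cs, ps))"

definition plant :: "'n::finite option rvec \<Rightarrow> 'n option rvec \<Rightarrow> real \<Rightarrow> real
    \<Rightarrow> 'n option rvec \<Rightarrow> 'n option rvec \<times> real \<Rightarrow> 'n option rvec \<times> real" where
  "plant L E C R d =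
     (\<lambda>(\<phi>, Q). (\<chi> k. - Q / C + E $ k * d $ k, (\<Sum>k\<in>UNIV. \<phi> $ k / L $ k) - Q / (R * C)))"

text \<open>The two parts of the controller do not have the load \<open>R\<close> among their arguments.\<close>

definition integrator :: "real \<Rightarrow> real \<Rightarrow> real \<Rightarrow> real \<Rightarrow> real" where
  "integrator C Qr ki Q = ki * ((Q - Qr) / C)"

definition feedback :: "(('n::{finite,linorder} option + 1) rvec \<Rightarrow> real)
    \<Rightarrow> 'n option rvec \<Rightarrow> 'n option rvec \<Rightarrow> real \<Rightarrow> real
    \<Rightarrow> 'n rvec \<Rightarrow> real \<Rightarrow> ('n, 'n) rmat \<Rightarrow> real \<Rightarrow> real
    \<Rightarrow> 'n option rvec \<times> real \<times> real \<Rightarrow> 'n option rvec" where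
  "feedback J L E C Qr Et Eeq K kd ki = (\<lambda>(\<phi>, Q, \<xi>).
     let z = Phi_inv L *v vsnoc \<phi> Q;
         \<C> = vinit (vinit z);
         \<phi>T = vlast (vinit z);
         mu = - (1 / Eeq) * (kd * (\<phi>T / L_par L UNIV) + kd * \<xi> +
               L_par L UNIV * ki * ((Q - Qr) / C));
         lam = - ((matrix_inv (diag Et) ** K) *v grad_Jz J L Qr \<C> \<phi>T)
     in Umat L E Et Eeq *v vsnoc lam mu)"

definition closed_loop :: "(('n::{finite,linorder} option + 1) rvec \<Rightarrow> real)
    \<Rightarrow> 'n option rvec \<Rightarrow> 'n option rvec \<Rightarrow> real \<Rightarrow> real \<Rightarrow> real
    \<Rightarrow> 'n rvec \<Rightarrow> real \<Rightarrow> ('n, 'n) rmat \<Rightarrow> real \<Rightarrow> real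
    \<Rightarrow> 'n option rvec \<times> real \<times> real \<Rightarrow> 'n option rvec \<times> real \<times> real" where
  "closed_loop J L E C Qr R Et Eeq K kd ki = (\<lambda>(\<phi>, Q, \<xi>).
     let d = feedback J L E C Qr Et Eeq K kd ki (\<phi>, Q, \<xi>);
         (\<phi>', Q') = plant L E C R d (\<phi>, Q)
     in (\<phi>', Q', integrator C Qr ki Q))"

definition feasible :: "'n::finite option rvec \<Rightarrow> 'n option rvec \<Rightarrow> real \<Rightarrow> real \<Rightarrow> real
    \<Rightarrow> 'n option rvec \<times> real \<Rightarrow> bool" where
  "feasible L E C Qr R x \<longleftrightarrow> snd x = Qr \<and> (\<exists>d. plant L E C R d x = 0)"

end

theory Submission
  imports Defs "HOL-Complex_Analysis.Great_Picard"
begin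

text \<open>
  Put \<open>\<sigma> = \<phi>\<^sub>T / L\<^sub>e\<^sub>q + \<xi>\<close>. In the coordinates \<open>(\<C>, \<sigma>, Q, \<xi>)\<close>, centred at the equilibrium, the closed
  loop is a cascade: \<open>u = (\<sigma>, Q, \<xi>)\<close> obeys a linear system with a strict quadratic Lyapunov
  function, hence decays exponentially, and it drives \<open>v' = - K (\<nabla>W(v) + h(v, \<phi>\<^sub>T))\<close>. By (F1) and (F2),
  \<open>W' \<le> - l \<parallel>\<nabla>W\<parallel>\<^sup>2 + \<beta> \<parallel>u\<parallel> (W + 1)\<close>. As \<open>\<parallel>u\<parallel>\<close> is integrable, \<open>W\<close>, which is coercive by strict
  convexity, stays bounded, and stays small if \<open>W(0)\<close> and \<open>u(0)\<close> are small. Convexity also gives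
  \<open>W(v) \<le> v \<bullet> \<nabla>W(v)\<close>, so that along a bounded solution \<open>\<nabla>W\<close> cannot vanish unless \<open>W\<close> does, and
  \<open>W\<close> tends to \<open>0\<close>. Since the vector field is merely continuous, solutions are obtained from
  Peano's theorem and continued by means of the a priori bounds.
\<close>

text \<open>The term \<open>L_eq k_i (Q - Q_r) / C\<close> in \<open>\<mu>\<close> is there for the
  sake of \<open>\<sigma>\<close>: its contribution to \<open>\<sigma>'\<close> cancels
  \<open>\<xi>'\<close>, so that \<open>\<sigma>\<close> is driven by damping and the deviation of
  the capacitor voltage alone, and the coupling terms drop out of the derivative of the quadratic
  energy. The obstacle lies in the nonlinear half. The perturbation \<open>h\<close> may grow
  linearly in \<open>v\<close>, so an input that merely tends to \<open>0\<close> could still cause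
  large excursions. (F1) extracts a factor \<open>\<parallel>u\<parallel>\<close>, (F2) turns
  \<open>\<parallel>\<nabla>W\<parallel> \<parallel>v\<parallel>\<close> into a multiple of
  \<open>W\<close>, and the result is linear in \<open>W\<close> with an integrable coefficient.
  \<open>W\<close> freezes \<open>\<phi>\<^sub>T\<close> at its positive equilibrium value, because
  convexity is assumed for positive \<open>\<phi>\<^sub>T\<close> while a trajectory may pass
  through other values; the deviation is put into \<open>h\<close>. As solutions need not be unique,
  limit sets are avoided in favour of an explicit monotone function. Feasibility fixes exactly
  \<open>Q\<close> and \<open>\<phi>\<^sub>T\<close>, so the optimization problem becomes the
  minimization of \<open>J_z\<close> over \<open>\<C>\<close> at the equilibrium value of
  \<open>\<phi>\<^sub>T\<close>.\<close>

section \<open>Existence of solutions\<close>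

text \<open>The approximants solve the delayed equation \<open>y'(t) = F(y(t - h))\<close>: iterating its integral
  operator \<open>j\<close> times determines \<open>y\<close> on \<open>(-\<infinity>, j h]\<close>, so that finitely many iterations suffice on
  \<open>[0, 1]\<close>.\<close>

lemma tonelli_approximation:
  fixes F :: "'a::euclidean_space \<Rightarrow> 'a"
  assumes contF: "continuous_on UNIV F" and bound: "\<And>x. norm (F x) \<le> M"
  shows "\<exists>y. M-lipschitz_on UNIV y \<and>
     (\<forall>t\<le>1. y t = p + integral {0..t} (\<lambda>s. F (y (s - 1 / real (Suc n)))))"
proof -
  define h where "h = 1 / real (Suc n)"
  define S where "S y t = p + integral {0..t} (\<lambda>s. F (y (s - h)))" for y t
  have M0: "0 \<le> M" using bound[of undefined] norm_ge_zero order_trans by blast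
  have contI: "continuous_on A (\<lambda>s. F (y (s - h)))" if "continuous_on UNIV y" for y A
  proof -
    have "continuous_on UNIV (\<lambda>s. F (y (s - h)))"
      by (rule continuous_on_compose2[OF contF]) (auto intro!: continuous_on_compose2[OF that] continuous_intros)
    then show ?thesis using continuous_on_subset by blast
  qed
  have lipS: "M-lipschitz_on UNIV (S y)" if y: "continuous_on UNIV y" for y
  proof -
    have mono: "norm (S y t - S y s) \<le> M * (t - s)" if "0 \<le> s" "s \<le> t" for s t
    proof -
      have "integral {0..s} (\<lambda>s. F (y (s - h))) + integral {s..t} (\<lambda>s. F (y (s - h)))
          = integral {0..t} (\<lambda>s. F (y (s - h)))"
        using that by (intro Henstock_Kurzweil_Integration.integral_combine
            integrable_continuous_interval contI[OF y]) auto
      then have "S y t - S y s = integral {s..t} (\<lambda>s. F (y (s - h)))"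
        by (simp add: S_def algebra_simps)
      also have "norm \<dots> \<le> M * (t - s)"
        using that bound by (intro integral_bound contI[OF y]) auto
      finally show ?thesis .
    qed
    \<comment> \<open>For \<open>t \<le> 0\<close> the integral over \<open>{0..t}\<close> vanishes,
      so \<open>S y\<close> has the constant value \<open>p\<close> there. This is the history that
      the delayed argument reads.\<close>
    have Smax: "S y t = S y (max 0 t)" for t
      by (cases "t \<le> 0") (auto simp: S_def max_def)
    have mono': "norm (S y t - S y s) \<le> M * (t - s)" if "s \<le> t" for s t
    proof -
      have "norm (S y t - S y s) \<le> M * (max 0 t - max 0 s)"
        using mono[of "max 0 s" "max 0 t"] Smax[of t] Smax[of s] that by simp
      also have "\<dots> \<le> M * (t - s)"
        using M0 that by (intro mult_left_mono) auto
      finally show ?thesis .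
    qed
    show ?thesis
    proof (rule lipschitz_onI[OF _ M0])
      fix s t :: real
      show "dist (S y s) (S y t) \<le> M * dist s t"
        using mono'[of s t] mono'[of t s] by (cases "s \<le> t") (auto simp: dist_norm norm_minus_commute)
    qed
  qed
  define y where "y j = (S ^^ j) (\<lambda>_. p)" for j
  have ySuc: "y (Suc j) = S (y j)" for j by (simp add: y_def)
  have liplip: "M-lipschitz_on UNIV (y j)" for j
  proof (induction j)
    case 0 then show ?case using M0 by (simp add: y_def lipschitz_on_def)
  next
    case (Suc j) then show ?case unfolding ySuc by (intro lipS lipschitz_on_continuous_on)
  qed
  have stable: "\<forall>t \<le> real j * h. S (y j) t = y j t" for j
  proof (induction j)
    case 0 then show ?case by (auto simp: y_def S_def)
  next
    case (Suc j)
    show ?case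
    proof (intro allI impI)
      fix t assume t: "t \<le> real (Suc j) * h"
      have "integral {0..t} (\<lambda>s. F (S (y j) (s - h))) = integral {0..t} (\<lambda>s. F (y j (s - h)))"
      proof (rule integral_cong)
        fix s assume "s \<in> {0..t}"
        then have "s - h \<le> real j * h" using t by (simp add: algebra_simps)
        then show "F (S (y j) (s - h)) = F (y j (s - h))" using Suc by simp
      qed
      then show "S (y (Suc j)) t = y (Suc j) t" by (simp add: ySuc S_def)
    qed
  qed
  have "real (Suc n) * h = 1" by (simp add: h_def)
  then have "\<forall>t\<le>1. S (y (Suc n)) t = y (Suc n) t" using stable[of "Suc n"] by simp
  then show ?thesis using liplip[of "Suc n"] unfolding S_def h_def by metis
qed

text \<open>As \<open>F\<close> is bounded by \<open>M\<close>, the delayed approximants are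
  \<open>M\<close>-Lipschitz, and Arzela-Ascoli yields a uniformly convergent subsequence. The delay
  shifts values by at most \<open>M\<close> times its length, so it disappears in the limit of the
  integral equation.\<close>

lemma peano_bounded:
  fixes F :: "'a::euclidean_space \<Rightarrow> 'a"
  assumes contF: "continuous_on UNIV F" and bound: "\<And>x. norm (F x) \<le> M"
  shows "\<exists>x. solves_on F {0..1} x \<and> x 0 = p"
proof -
  define h where "h n = 1 / real (Suc n)" for n
  obtain y where lip: "\<And>n. M-lipschitz_on UNIV (y n)"
    and y: "\<And>n t. t \<le> 1 \<Longrightarrow> y n t = p + integral {0..t} (\<lambda>s. F (y n (s - h n)))"
    using tonelli_approximation[OF contF bound, of p] unfolding h_def by metis
  have M0: "0 \<le> M" using bound[of undefined] norm_ge_zero order_trans by blast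
  have contI: "continuous_on A (\<lambda>s. F (y n (s - h n)))" for n A
  proof -
    have "continuous_on UNIV (\<lambda>s. F (y n (s - h n)))"
      by (rule continuous_on_compose2[OF contF])
         (auto intro!: continuous_on_compose2[OF lipschitz_on_continuous_on[OF lip]] continuous_intros)
    then show ?thesis using continuous_on_subset by blast
  qed
  have lipD: "norm (y n s - y n t) \<le> M * \<bar>s - t\<bar>" for n s t
    using lipschitz_onD[OF lip[of n], of s t] by (simp add: dist_norm)
  have y0: "y n 0 = p" for n using y[of 0 n] by simp
  have bd: "norm (y n t) \<le> norm p + M" if "t \<in> {0..1}" for n t
  proof -
    have "norm (y n t) \<le> norm p + norm (y n t - y n 0)"
      using norm_triangle_ineq[of p "y n t - p"] y0 by simp
    also have "norm (y n t - y n 0) \<le> M * 1"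
      using lipD[of n t 0] that M0 mult_left_mono[of "\<bar>t\<bar>" 1 M] by auto
    finally show ?thesis by simp
  qed
  obtain x k where contx: "continuous_on {0..1} x" and k: "strict_mono (k :: nat \<Rightarrow> nat)"
    and lim: "\<And>e. 0 < e \<Longrightarrow> \<exists>N. \<forall>n t. n \<ge> N \<and> t \<in> {0..1} \<longrightarrow> norm (y (k n) t - x t) < e"
  proof (rule Arzela_Ascoli[of "{0..1::real}" y "norm p + M"])
    show "\<And>n t. t \<in> {0..1} \<Longrightarrow> norm (y n t) \<le> norm p + M" by (rule bd)
    fix t e :: real assume "t \<in> {0..1}" "0 < e"
    show "\<exists>d. 0 < d \<and> (\<forall>n s. s \<in> {0..1} \<and> norm (t - s) < d \<longrightarrow> norm (y n t - y n s) < e)"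
    \<comment> \<open>The \<open>+ 1\<close> covers the case \<open>M = 0\<close>.\<close>
    proof (intro exI[of _ "e / (M + 1)"] conjI allI impI)
      show "0 < e / (M + 1)" using \<open>0 < e\<close> M0 by simp
      fix n s assume "s \<in> {0..1} \<and> norm (t - s) < e / (M + 1)"
      then have "\<bar>t - s\<bar> * (M + 1) < e" using M0 by (simp add: pos_less_divide_eq)
      moreover have "M * \<bar>t - s\<bar> \<le> \<bar>t - s\<bar> * (M + 1)" by (simp add: algebra_simps)
      ultimately show "norm (y n t - y n s) < e" using lipD[of n t s] by linarith
    qed
  qed auto
  have limp: "(\<lambda>n. y (k n) t) \<longlonglongrightarrow> x t" if "t \<in> {0..1}" for t
  proof (rule LIMSEQ_I)
    fix e :: real assume "0 < e"
    show "\<exists>N. \<forall>n\<ge>N. norm (y (k n) t - x t) < e"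
      using lim[OF \<open>0 < e\<close>] that by blast
  qed
  have h0: "(\<lambda>n. h (k n)) \<longlonglongrightarrow> 0"
    using LIMSEQ_subseq_LIMSEQ[OF LIMSEQ_Suc[OF lim_1_over_n] k]
    by (simp add: h_def o_def)
  have limd: "(\<lambda>n. F (y (k n) (t - h (k n)))) \<longlonglongrightarrow> F (x t)" if t: "t \<in> {0..1}" for t
  proof -
    have "(\<lambda>n. y (k n) (t - h (k n)) - y (k n) t) \<longlonglongrightarrow> 0"
    proof (rule Lim_null_comparison)
      show "\<forall>\<^sub>F n in sequentially. norm (y (k n) (t - h (k n)) - y (k n) t) \<le> M * \<bar>h (k n)\<bar>"
        using lipD[of _ "t - h _" t] by (intro always_eventually allI) (metis abs_minus_cancel add_diff_cancel_left' minus_diff_eq diff_add_cancel)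
      show "(\<lambda>n. M * \<bar>h (k n)\<bar>) \<longlonglongrightarrow> 0"
        using tendsto_mult_right_zero[OF tendsto_rabs_zero[OF h0], of M] by simp
    qed
    from tendsto_add[OF this limp[OF t]] have "(\<lambda>n. y (k n) (t - h (k n))) \<longlonglongrightarrow> x t" by simp
    then show ?thesis
      using contF continuous_on_tendsto_compose[of UNIV F] by (simp add: always_eventually)
  qed
  have x: "x t = p + integral {0..t} (\<lambda>s. F (x s))" if t: "t \<in> {0..1}" for t
  proof -
    have "(\<lambda>n. integral {0..t} (\<lambda>s. F (y (k n) (s - h (k n))))) \<longlonglongrightarrow> integral {0..t} (\<lambda>s. F (x s))"
      by (rule dominated_convergence(2)[where h="\<lambda>_. M"])
         (use t in \<open>auto intro!: integrable_continuous_interval contI bound limd\<close>)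
    from tendsto_add[OF tendsto_const[of p] this]
    have "(\<lambda>n. y (k n) t) \<longlonglongrightarrow> p + integral {0..t} (\<lambda>s. F (x s))"
      using t y by simp
    then show ?thesis using limp[OF t] LIMSEQ_unique by blast
  qed
  have cFx: "continuous_on {0..1} (\<lambda>s. F (x s))"
    using continuous_on_compose2[OF contF contx] by simp
  have "solves_on F {0..1} x"
    unfolding solves_on_def
  proof
    fix t :: real assume t: "t \<in> {0..1}"
    have "((\<lambda>u. p + integral {0..u} (\<lambda>s. F (x s))) has_vector_derivative F (x t)) (at t within {0..1})"
      using integral_has_vector_derivative[OF cFx t] has_vector_derivative_add[OF has_vector_derivative_const]
      by fastforce
    then show "(x has_vector_derivative F (x t)) (at t within {0..1})"
      by (rule has_vector_derivative_transform[OF t, rotated]) (simp add: x)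
  qed
  moreover have "x 0 = p" using x[of 0] by simp
  ultimately show ?thesis by blast
qed


section \<open>Restriction, translation and gluing of solutions\<close>

lemma solves_on_subset: "solves_on F I x \<Longrightarrow> I' \<subseteq> I \<Longrightarrow> solves_on F I' x"
  unfolding solves_on_def by (meson has_vector_derivative_within_subset subsetD)

lemma solves_on_cong:
  "solves_on F I x \<Longrightarrow> (\<And>t. t \<in> I \<Longrightarrow> F (x t) = G (x t)) \<Longrightarrow> solves_on G I x"
  unfolding solves_on_def by simp

lemma solves_on_transform:
  assumes "solves_on F I x" "\<And>t. t \<in> I \<Longrightarrow> y t = x t"
  shows "solves_on F I y"
  unfolding solves_on_def
proof
  fix t assume t: "t \<in> I"
  have "(x has_vector_derivative F (y t)) (at t within I)"
    using assms t by (auto simp: solves_on_def)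
  then show "(y has_vector_derivative F (y t)) (at t within I)"
    by (rule has_vector_derivative_transform[OF t, rotated]) (rule assms(2))
qed

lemma solves_on_continuous_on: "solves_on F I x \<Longrightarrow> continuous_on I x"
  unfolding solves_on_def continuous_on_eq_continuous_within
  using has_vector_derivative_continuous by blast

lemma solves_on_shift:
  assumes "solves_on F I x"
  shows "solves_on F ((+) b ` I) (\<lambda>t. x (t - b))"
  unfolding solves_on_def
proof
  fix t assume "t \<in> (+) b ` I"
  then have t: "t - b \<in> I" by auto
  have im: "(\<lambda>t. t - b) ` (+) b ` I = I" by (auto simp: image_image)
  have "((\<lambda>t. t - b) has_vector_derivative 1) (at t within (+) b ` I)"
    by (auto intro!: derivative_eq_intros)
  moreover have "(x has_vector_derivative F (x (t - b))) (at (t - b) within (\<lambda>t. t - b) ` (+) b ` I)"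
    using assms t unfolding im solves_on_def by blast
  ultimately show "((\<lambda>t. x (t - b)) has_vector_derivative F (x (t - b))) (at t within (+) b ` I)"
    using vector_diff_chain_within[of "\<lambda>t. t - b" 1 t "(+) b ` I" x] by (simp add: o_def)
qed

text \<open>At the junction both one-sided derivatives equal \<open>F\<close> at the common value,
  so matching values suffice. Leaving \<open>J\<close> general covers both a further bounded piece
  and a final ray.\<close>

lemma solves_on_concat:
  assumes x: "solves_on F {a..b} x" and y: "solves_on F J y" and "x b = y b"
    and "a \<le> b" "b \<in> J" "J \<subseteq> {b..}" "closed J"
  shows "solves_on F ({a..b} \<union> J) (\<lambda>t. if t \<in> {a..b} then x t else y t)"
  unfolding solves_on_def
proof
  fix t assume t: "t \<in> {a..b} \<union> J"
  have cl: "closure {a..b} \<inter> closure J = {b}" using assms by auto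
  have un: "{a..b} \<union> {b} = {a..b}" "J \<union> {b} = J" using assms by auto
  have b: "t = b" if "t \<in> closure {a..b}" "t \<in> closure J" using cl that by blast
  have "((\<lambda>t. if t \<in> {a..b} then x t else y t) has_vector_derivative
     (if t \<in> {a..b} then F (x t) else F (y t))) (at t within {a..b} \<union> J)"
  proof (rule has_vector_derivative_If_within_closures[OF t refl], unfold cl un)
    show "t \<in> {a..b} \<Longrightarrow> (x has_vector_derivative F (x t)) (at t within {a..b})"
      using x by (simp add: solves_on_def)
    show "t \<in> J \<Longrightarrow> (y has_vector_derivative F (y t)) (at t within J)"
      using y by (simp add: solves_on_def)
    show "t \<in> closure {a..b} \<Longrightarrow> t \<in> closure J \<Longrightarrow> x t = y t"
      "t \<in> closure {a..b} \<Longrightarrow> t \<in> closure J \<Longrightarrow> F (x t) = F (y t)" using b assms(3) by auto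
  qed
  then show "((\<lambda>t. if t \<in> {a..b} then x t else y t) has_vector_derivative
     F (if t \<in> {a..b} then x t else y t)) (at t within {a..b} \<union> J)" by (simp only: if_distrib[of F])
qed

section \<open>Continuation by a priori bounds\<close>

lemma continuous_bounded_on_cball:
  fixes F :: "'a::euclidean_space \<Rightarrow> 'b::real_normed_vector"
  assumes "continuous_on UNIV F"
  obtains M where "0 \<le> M" "\<And>x. norm x \<le> r \<Longrightarrow> norm (F x) \<le> M"
proof -
  have "compact (F ` cball 0 r)"
    by (intro compact_continuous_image continuous_on_subset[OF assms]) auto
  then have "bounded (F ` cball 0 r)" by (rule compact_imp_bounded)
  then obtain M where "0 < M" "\<forall>y\<in>F ` cball 0 r. norm y \<le> M" using bounded_pos by blast
  then show thesis by (intro that[of M]) auto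
qed

text \<open>Composing \<open>F\<close> with the projection onto a ball of radius
  \<open>r > B\<close> makes it bounded without changing it inside the ball. While the solution of
  the modified equation stays inside, it solves the original one, and then the a priori bound keeps
  it away from the boundary. The existence time \<open>1\<close> is the same for all initial
  states.\<close>

lemma local_existence:
  fixes F :: "'a::euclidean_space \<Rightarrow> 'a"
  assumes contF: "continuous_on UNIV F"
    and apriori: "\<And>T x t. 0 < T \<Longrightarrow> solves_on F {0..<T} x \<Longrightarrow> x 0 = p \<Longrightarrow> t \<in> {0..<T} \<Longrightarrow> norm (x t) \<le> B"
  shows "\<exists>x. solves_on F {0..1} x \<and> x 0 = p"
proof -
  define r where "r = max B (norm p) + 1"
  have pr: "norm p < r" "B < r" "0 < r" unfolding r_def using norm_ge_zero[of p] by linarith+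
  define \<pi> where "\<pi> = closest_point (cball (0::'a) r)"
  have c\<pi>: "continuous_on UNIV \<pi>" unfolding \<pi>_def using pr by (intro continuous_on_closest_point) auto
  have \<pi>in: "\<pi> x \<in> cball 0 r" for x unfolding \<pi>_def using pr by (intro closest_point_in_set) auto
  have \<pi>id: "\<pi> x = x" if "norm x \<le> r" for x
    unfolding \<pi>_def using that by (intro closest_point_self) simp
  obtain M where M: "\<And>x. norm x \<le> r \<Longrightarrow> norm (F x) \<le> M"
    using continuous_bounded_on_cball[OF contF] by blast
  have "continuous_on UNIV (\<lambda>x. F (\<pi> x))"
    by (rule continuous_on_compose2[OF contF c\<pi>]) simp
  moreover have "norm (F (\<pi> x)) \<le> M" for x using M \<pi>in[of x] by simp
  ultimately obtain x where x: "solves_on (\<lambda>x. F (\<pi> x)) {0..1} x" and x0: "x 0 = p"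
    using peano_bounded by blast
  have small: "norm (x t) < r" if "t \<in> {0..1}" for t
  proof (rule ccontr)
    assume "\<not> norm (x t) < r"
    \<comment> \<open>\<open>S\<close> is compact, so it has a least element \<open>\<tau>\<close>,
      the first time at which the norm reaches \<open>r\<close>. The a priori bound holds on
      \<open>{0..<\<tau>}\<close> and passes to \<open>\<tau>\<close> by continuity, which
      contradicts \<open>B < r\<close>.\<close>
    define S where "S = {t\<in>{0..1}. r \<le> norm (x t)}"
    have cx: "continuous_on {0..1} x" using solves_on_continuous_on[OF x] .
    have "S \<noteq> {}" using \<open>\<not> norm (x t) < r\<close> that by (auto simp: S_def)
    moreover have "compact S"
    proof -
      have "closed ({0..1} \<inter> (\<lambda>t. norm (x t)) -` {r..})"
        by (intro continuous_closed_preimage continuous_on_norm cx) auto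
      moreover have "{0..1} \<inter> (\<lambda>t. norm (x t)) -` {r..} = S" by (auto simp: S_def)
      ultimately have "closed S" by simp
      then have "compact ({0..1} \<inter> S)" by (intro compact_Int_closed) auto
      moreover have "{0..1} \<inter> S = S" unfolding S_def by blast
      ultimately show ?thesis by simp
    qed
    ultimately obtain \<tau> where \<tau>: "\<tau> \<in> S" and least: "\<And>s. s \<in> S \<Longrightarrow> \<tau> \<le> s"
      using compact_attains_inf[of S] by metis
    have "\<tau> \<noteq> 0" using \<tau> x0 pr by (auto simp: S_def)
    then have \<tau>0: "0 < \<tau>" "\<tau> \<le> 1" using \<tau> by (auto simp: S_def)
    have lt: "norm (x s) < r" if "s \<in> {0..<\<tau>}" for s
      using least[of s] that \<tau>0 by (force simp: S_def)
    have "solves_on F {0..<\<tau>} x"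
      by (rule solves_on_cong[OF solves_on_subset[OF x]]) (use lt \<tau>0 in \<open>auto simp: \<pi>id less_imp_le\<close>)
    then have le: "norm (x s) \<le> B" if "s \<in> {0..<\<tau>}" for s using apriori \<tau>0 x0 that by blast
    have "norm (x \<tau>) \<le> B"
    proof (rule tendsto_upperbound)
      have "continuous (at \<tau> within {0..1}) x"
        using cx \<tau>0 by (simp add: continuous_on_eq_continuous_within)
      then have "(x \<longlongrightarrow> x \<tau>) (at \<tau> within {0..<\<tau>})"
        unfolding continuous_within by (rule tendsto_within_subset) (use \<tau>0 in auto)
      then show "((\<lambda>s. norm (x s)) \<longlongrightarrow> norm (x \<tau>)) (at \<tau> within {0..<\<tau>})" by (rule tendsto_norm)
      show "\<forall>\<^sub>F s in at \<tau> within {0..<\<tau>}. norm (x s) \<le> B"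
        using le by (auto simp: eventually_at_topological)
      show "at \<tau> within {0..<\<tau>} \<noteq> bot"
        using \<tau>0 by (simp add: trivial_limit_within islimpt_in_closure)
    qed
    then show False using \<tau> pr by (auto simp: S_def)
  qed
  then have "solves_on F {0..1} x"
    by (intro solves_on_cong[OF x]) (auto simp: \<pi>id less_imp_le)
  then show ?thesis using x0 by blast
qed

text \<open>Pieces of unit length are appended one after another. Without uniqueness, solutions
  chosen separately on longer and longer intervals need not agree, hence the dependent choice: each
  solution extends the one chosen before.\<close>

lemma global_existence:
  fixes F :: "'a::euclidean_space \<Rightarrow> 'a"
  assumes loc: "\<And>p. \<exists>x. solves_on F {0..1} x \<and> x 0 = p"
  shows "\<exists>x. solves_on F {0..} x \<and> x 0 = p"
proof -
  define P where "P n x \<longleftrightarrow> solves_on F {0..real (Suc n)} x \<and> x 0 = p" for n x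
  have "\<exists>X. \<forall>n. P n (X n) \<and> (\<forall>t\<in>{0..real (Suc n)}. X (Suc n) t = X n t)"
  proof (rule dependent_nat_choice)
    show "\<exists>x. P 0 x" using loc unfolding P_def by simp
    fix x n assume x: "P n x"
    obtain y where y: "solves_on F {0..1} y" "y 0 = x (real (Suc n))" using loc by blast
    define b where "b = real (Suc n)"
    have "solves_on F {b..b + 1} (\<lambda>t. y (t - b))"
      using solves_on_shift[OF y(1), of b] by (simp add: add.commute[of 1])
    then have "solves_on F ({0..b} \<union> {b..b + 1}) (\<lambda>t. if t \<in> {0..b} then x t else y (t - b))"
      using x y(2) by (intro solves_on_concat) (auto simp: b_def P_def)
    moreover have "{0..b} \<union> {b..b + 1} = {0..real (Suc (Suc n))}" by (auto simp: b_def)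
    ultimately have "P (Suc n) (\<lambda>t. if t \<in> {0..b} then x t else y (t - b))"
      using x by (simp add: P_def b_def)
    then show "\<exists>y. P (Suc n) y \<and> (\<forall>t\<in>{0..real (Suc n)}. y t = x t)"
      by (intro exI[of _ "\<lambda>t. if t \<in> {0..b} then x t else y (t - b)"]) (auto simp: b_def)
  qed
  then obtain X where X: "\<And>n. solves_on F {0..real (Suc n)} (X n)" "\<And>n. X n 0 = p"
    and step: "\<And>n t. t \<in> {0..real (Suc n)} \<Longrightarrow> X (Suc n) t = X n t" unfolding P_def by metis
  have agree: "X (n + j) t = X n t" if "t \<in> {0..real (Suc n)}" for n j t
    using that by (induction j) (auto simp: step)
  \<comment> \<open>By \<open>agree\<close>, every index \<open>n\<close> with
    \<open>t \<le> n + 1\<close> gives the same value; \<open>nat \<lceil>t\<rceil>\<close> is one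
    such index.\<close>
  define x where "x t = X (nat \<lceil>t\<rceil>) t" for t
  have xX: "x t = X n t" if "t \<in> {0..real (Suc n)}" for n t
  proof -
    have "t \<le> real (Suc (nat \<lceil>t\<rceil>))" by linarith
    then show ?thesis
      using agree[of t "nat \<lceil>t\<rceil>" "n - nat \<lceil>t\<rceil>"] agree[of t n "nat \<lceil>t\<rceil> - n"] that
      by (cases "nat \<lceil>t\<rceil> \<le> n") (auto simp: x_def)
  qed
  have "(x has_vector_derivative F (x t)) (at t within {0..})" if t: "t \<ge> 0" for t
  proof -
    define n where "n = nat \<lceil>t\<rceil>"
    have tn: "t < real (Suc n)" unfolding n_def by linarith
    have "solves_on F {0..real (Suc n)} x" using solves_on_transform[OF X(1)] xX by blast
    then have "(x has_vector_derivative F (x t)) (at t within {0..real (Suc n)})"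
      using t tn by (simp add: solves_on_def)
    moreover have "at t within {0..real (Suc n)} = at t within {0..}"
      using tn by (intro at_within_nhd[of _ "{..<real (Suc n)}"]) auto
    ultimately show ?thesis by simp
  qed
  moreover have "x 0 = p" using xX[of 0 0] X(2) by simp
  ultimately show ?thesis unfolding solves_on_def by auto
qed

text \<open>A bounded trajectory has bounded velocity, hence is Lipschitz and extends continuously
  to \<open>T\<close>. The differential equation at \<open>T\<close> itself comes from the integral
  form.\<close>

lemma bounded_solution_extends_to_closed:
  fixes F :: "'a::euclidean_space \<Rightarrow> 'a"
  assumes contF: "continuous_on UNIV F" and "0 < T"
    and x: "solves_on F {0..<T} x" and B: "\<And>t. t \<in> {0..<T} \<Longrightarrow> norm (x t) \<le> B"
  shows "\<exists>y. solves_on F {0..T} y \<and> (\<forall>t\<in>{0..<T}. y t = x t)"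
proof -
  obtain M where M0: "0 \<le> M" and M: "\<And>x. norm x \<le> B \<Longrightarrow> norm (F x) \<le> M"
    using continuous_bounded_on_cball[OF contF] by blast
  have "M-lipschitz_on {0..<T} x"
  proof (rule lipschitz_onI[OF _ M0])
    fix s t assume st: "s \<in> {0..<T}" "t \<in> {0..<T}"
    have "norm (x s - x t) \<le> M * norm (s - t)"
    proof (rule differentiable_bound[of "{0..<T}" x "\<lambda>t h. h *\<^sub>R F (x t)"])
      fix u assume "u \<in> {0..<T}"
      then show "(x has_derivative (\<lambda>h. h *\<^sub>R F (x u))) (at u within {0..<T})"
        using x by (auto simp: solves_on_def has_vector_derivative_def)
      show "onorm (\<lambda>h. h *\<^sub>R F (x u)) \<le> M"
      proof (rule onorm_le)
        fix h :: real
        have "norm (F (x u)) \<le> M" using M[of "x u"] B[OF \<open>u \<in> {0..<T}\<close>] by simp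
        then show "norm (h *\<^sub>R F (x u)) \<le> M * norm h"
          by (simp add: mult.commute[of M] mult_left_mono)
      qed
    qed (use st in auto)
    then show "dist (x s) (x t) \<le> M * dist s t" by (simp add: dist_norm)
  qed
  then have "uniformly_continuous_on {0..<T} x" by (rule lipschitz_on_uniformly_continuous)
  then obtain y where uc: "uniformly_continuous_on (closure {0..<T}) y"
    and yx: "\<And>t. t \<in> {0..<T} \<Longrightarrow> x t = y t"
    by (rule uniformly_continuous_on_extension_on_closure) blast
  have cy: "continuous_on {0..T} y"
    using uniformly_continuous_imp_continuous[OF uc] \<open>0 < T\<close> by simp
  have cFy: "continuous_on {0..T} (\<lambda>s. F (y s))"
    using continuous_on_compose2[OF contF cy] by simp
  \<comment> \<open>The fundamental theorem asks for derivatives in the open interval only, so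
    nothing has to be known at the end point. Differentiating the integral then supplies the
    one-sided derivative at \<open>T\<close>.\<close>
  have yint: "y t = y 0 + integral {0..t} (\<lambda>s. F (y s))" if t: "t \<in> {0..T}" for t
  proof -
    have "((\<lambda>s. F (y s)) has_integral (y t - y 0)) {0..t}"
    proof (rule fundamental_theorem_of_calculus_interior)
      show "continuous_on {0..t} y" by (rule continuous_on_subset[OF cy]) (use t in auto)
      fix s assume s: "s \<in> {0<..<t}"
      have "solves_on F {0<..<t} x" by (rule solves_on_subset[OF x]) (use t in auto)
      then have "solves_on F {0<..<t} y" by (rule solves_on_transform) (use t yx in auto)
      then show "(y has_vector_derivative F (y s)) (at s)"
        using s at_within_open[of s "{0<..<t}"] unfolding solves_on_def by fastforce
    qed (use t in auto)
    then show ?thesis by (simp add: integral_unique)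
  qed
  have "solves_on F {0..T} y"
    unfolding solves_on_def
  proof
    fix t :: real assume t: "t \<in> {0..T}"
    have "((\<lambda>u. y 0 + integral {0..u} (\<lambda>s. F (y s))) has_vector_derivative F (y t)) (at t within {0..T})"
      using integral_has_vector_derivative[OF cFy t] has_vector_derivative_add[OF has_vector_derivative_const]
      by fastforce
    then show "(y has_vector_derivative F (y t)) (at t within {0..T})"
      by (rule has_vector_derivative_transform[OF t, rotated]) (rule yint)
  qed
  then show ?thesis using yx by auto
qed

text \<open>The bound may depend on the initial state but not on \<open>T\<close> or on the
  solution, which excludes blow-up. A solution on \<open>{0..<T}\<close> is closed up at
  \<open>T\<close> and continued by a global solution starting from its end value.\<close>

lemma forward_complete_if_bounded:
  fixes F :: "'a::euclidean_space \<Rightarrow> 'a"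
  assumes contF: "continuous_on UNIV F"
    and apriori: "\<And>p. \<exists>B. \<forall>T>0. \<forall>x. solves_on F {0..<T} x \<longrightarrow> x 0 = p \<longrightarrow> (\<forall>t\<in>{0..<T}. norm (x t) \<le> B)"
  shows "forward_complete F"
proof -
  have "\<exists>x. solves_on F {0..1} x \<and> x 0 = p" for p
  proof -
    obtain B where "\<forall>T>0. \<forall>x. solves_on F {0..<T} x \<longrightarrow> x 0 = p \<longrightarrow> (\<forall>t\<in>{0..<T}. norm (x t) \<le> B)"
      using apriori by blast
    then show ?thesis by (intro local_existence[OF contF, of p B]) blast
  qed
  then have glob: "\<exists>x. solves_on F {0..} x \<and> x 0 = p" for p using global_existence by blast
  moreover have "\<exists>y. solves_on F {0..} y \<and> (\<forall>t\<in>{0..<T}. y t = x t)"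
    if T: "T > 0" and x: "solves_on F {0..<T} x" for T x
  proof -
    obtain B where "\<forall>t\<in>{0..<T}. norm (x t) \<le> B" using apriori[of "x 0"] T x by blast
    then obtain z where z: "solves_on F {0..T} z" "\<forall>t\<in>{0..<T}. z t = x t"
      using bounded_solution_extends_to_closed[OF contF T x] by blast
    obtain w where w: "solves_on F {0..} w" "w 0 = z T" using glob by blast
    have "solves_on F {T..} (\<lambda>t. w (t - T))" using solves_on_shift[OF w(1), of T] by simp
    then have "solves_on F ({0..T} \<union> {T..}) (\<lambda>t. if t \<in> {0..T} then z t else w (t - T))"
      using z(1) w(2) T by (intro solves_on_concat) auto
    moreover have "{0..T} \<union> {T..} = {0..}" using T by auto
    ultimately show ?thesis
      using z(2) by (intro exI[of _ "\<lambda>t. if t \<in> {0..T} then z t else w (t - T)"]) auto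
  qed
  ultimately show ?thesis unfolding forward_complete_def by blast
qed

section \<open>Cascades driven by an exponentially decaying input\<close>

text \<open>\<open>solves_on\<close> yields derivatives within the time interval, which are
  one-sided at its end points. Continuity up to the end points and ordinary derivatives in the
  interior are enough for monotonicity.\<close>

lemma nonincreasing_if_deriv_nonpos_within:
  fixes f f' :: "real \<Rightarrow> real"
  assumes f: "\<And>t. t \<in> I \<Longrightarrow> (f has_real_derivative f' t) (at t within I)"
    and neg: "\<And>t. t \<in> I \<Longrightarrow> f' t \<le> 0" and "is_interval I" "s \<in> I" "t \<in> I" "s \<le> t"
  shows "f t \<le> f s"
proof -
  have sub: "{s..t} \<subseteq> I"
    using assms(3-5) by (meson atLeastAtMost_iff mem_is_interval_1_I subsetI)
  have f_sub: "(f has_real_derivative f' u) (at u within {s..t})" if "u \<in> {s..t}" for u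
    using f[of u] that sub by (meson DERIV_subset subsetD)
  show ?thesis
  proof (rule DERIV_nonpos_imp_decreasing_open[OF \<open>s \<le> t\<close>])
    show "continuous_on {s..t} f" using f_sub by (rule DERIV_continuous_on)
    fix u assume u: "s < u" "u < t"
    then have "(f has_real_derivative f' u) (at u)"
      using f_sub[of u] at_within_Icc_at[of s u t] by simp
    then show "\<exists>y. (f has_real_derivative y) (at u) \<and> y \<le> 0"
      using neg[of u] u subsetD[OF sub, of u] by auto
  qed
qed

text \<open>The error system, reduced to the properties that the convergence argument uses.
  \<open>W_scaled\<close> is convexity along rays from the minimum, \<open>W_growth\<close> and
  \<open>H_bound\<close> are the consequences of (F2) and (F1), and the linear block enters through
  its decay. \<open>A_decay\<close> speaks of solutions on \<open>{0..<T}\<close> because it also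
  serves to rule out finite escape times.\<close>

locale cascade =
  fixes W :: "'a::euclidean_space \<Rightarrow> real" and gW :: "'a \<Rightarrow> 'a"
    and H :: "'a \<Rightarrow> 'b::euclidean_space \<Rightarrow> 'a" and K :: "'a \<Rightarrow> 'a" and A :: "'b \<Rightarrow> 'b"
    and c \<alpha> :: real
  assumes W_gderiv: "\<And>v. GDERIV W v :> gW v"
    and gW_cont: "continuous_on UNIV gW"
    and H_cont: "continuous_on UNIV (\<lambda>(v, u). H v u)"
    and K_linear: "bounded_linear K" and A_linear: "bounded_linear A"
    and K_pos: "\<And>v. v \<noteq> 0 \<Longrightarrow> v \<bullet> K v > 0"
    and W_zero: "W 0 = 0" and W_pos: "\<And>v. v \<noteq> 0 \<Longrightarrow> W v > 0"
    and W_scaled: "\<And>t v. 0 \<le> t \<Longrightarrow> t \<le> 1 \<Longrightarrow> W (t *\<^sub>R v) \<le> t * W v"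
    and W_growth: "\<exists>k\<ge>0. \<forall>v. norm (gW v) * (1 + norm v) \<le> k * (W v + 1)"
    and H_bound: "\<And>r. 0 < r \<Longrightarrow>
      \<exists>\<kappa>\<ge>0. \<forall>v u. norm u \<le> r \<longrightarrow> norm (H v u) \<le> \<kappa> * norm u * (1 + norm v)"
    and c_pos: "0 < c" and \<alpha>_pos: "0 < \<alpha>"
    and A_decay: "\<And>T u t. 0 < T \<Longrightarrow> solves_on A {0..<T} u \<Longrightarrow> t \<in> {0..<T} \<Longrightarrow>
      norm (u t) \<le> c * exp (- \<alpha> * t) * norm (u 0)"
begin

definition F :: "'a \<times> 'b \<Rightarrow> 'a \<times> 'b" where
  "F = (\<lambda>(v, u). (- K (gW v + H v u), A u))"

lemma W_nonneg: "0 \<le> W v"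
  using W_pos[of v] W_zero by (cases "v = 0") auto

lemma W_cont: "continuous_on S W"
  using W_gderiv has_derivative_continuous unfolding gderiv_def
  by (intro continuous_at_imp_continuous_on ballI) blast

lemma F_cont: "continuous_on UNIV F"
proof -
  have "continuous_on UNIV (\<lambda>x. K (gW (fst x) + H (fst x) (snd x)))"
    using H_cont continuous_on_compose2[OF gW_cont continuous_on_fst[OF continuous_on_id]]
    by (intro continuous_on_compose2[OF linear_continuous_on[OF K_linear, of UNIV]] continuous_on_add)
       (auto simp: case_prod_unfold)
  moreover have "continuous_on UNIV (\<lambda>x::'a \<times> 'b. A (snd x))"
    by (intro continuous_on_compose2[OF linear_continuous_on[OF A_linear, of UNIV]] continuous_intros) auto
  ultimately show ?thesis unfolding F_def case_prod_unfold by (intro continuous_intros)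
qed

lemma gW_zero: "gW 0 = 0"
proof -
  have "(\<lambda>h. h \<bullet> gW 0) = (\<lambda>h. 0)"
    by (rule differential_zero_maxmin[of 0 UNIV W])
       (use W_gderiv[of 0] W_nonneg W_zero in \<open>auto simp: gderiv_def\<close>)
  then show ?thesis by (metis inner_eq_zero_iff)
qed

text \<open>By \<open>W_scaled\<close>, the quotient \<open>W v / norm v\<close> is at least the one
  at the point of the sphere of radius \<open>\<epsilon>\<close> in the same direction, and
  \<open>W\<close> has a positive minimum on that sphere. Large \<open>v\<close> give boundedness,
  small \<open>\<epsilon>\<close> gives stability and convergence.\<close>

lemma W_coercive:
  assumes "0 < \<epsilon>"
  obtains m where "0 < m" "\<And>v. \<epsilon> \<le> norm v \<Longrightarrow> m * norm v \<le> W v"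
proof -
  have "sphere (0::'a) \<epsilon> \<noteq> {}" using assms by simp
  then obtain w where w: "w \<in> sphere 0 \<epsilon>" "\<And>v. v \<in> sphere 0 \<epsilon> \<Longrightarrow> W w \<le> W v"
    using continuous_attains_inf[OF compact_sphere _ W_cont] by metis
  show thesis
  proof (rule that[of "W w / \<epsilon>"])
    show "0 < W w / \<epsilon>" using W_pos[of w] w assms by force
    fix v :: 'a assume v: "\<epsilon> \<le> norm v"
    then have "0 < norm v" using assms by linarith
    have "W w \<le> W ((\<epsilon> / norm v) *\<^sub>R v)" using \<open>0 < norm v\<close> assms by (intro w) auto
    also have "\<dots> \<le> \<epsilon> / norm v * W v"
      using v \<open>0 < norm v\<close> assms by (intro W_scaled) (auto simp: divide_le_eq_1)
    finally show "W w / \<epsilon> * norm v \<le> W v" using \<open>0 < norm v\<close> assms by (simp add: field_simps)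
  qed
qed

text \<open>Along the ray through \<open>v\<close>, the difference \<open>g\<close> between
  \<open>W\<close> and its chord is nonpositive on \<open>[0, 1]\<close> and vanishes at
  \<open>1\<close>. Its derivative there, \<open>v \<bullet> gW v - W v\<close>, therefore cannot be
  negative.\<close>

lemma W_le_inner_gW: "W v \<le> v \<bullet> gW v"
proof (rule ccontr)
  assume "\<not> W v \<le> v \<bullet> gW v"
  define g where "g s = W (s *\<^sub>R v) - s * W v" for s
  have "((\<lambda>s. s *\<^sub>R v) has_derivative (\<lambda>h. h *\<^sub>R v)) (at 1)" by (auto intro!: derivative_eq_intros)
  moreover have "(W has_derivative (\<lambda>h. h \<bullet> gW v)) (at (1 *\<^sub>R v))"
    using W_gderiv[of v] by (simp add: gderiv_def)
  ultimately have "((\<lambda>s. W (s *\<^sub>R v)) has_derivative (\<lambda>h. (h *\<^sub>R v) \<bullet> gW v)) (at 1)"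
    by (rule has_derivative_compose)
  then have "((\<lambda>s. W (s *\<^sub>R v)) has_real_derivative (v \<bullet> gW v)) (at 1)"
    unfolding has_field_derivative_def
    by (rule has_derivative_eq_rhs) (simp add: fun_eq_iff)
  then have "(g has_real_derivative (v \<bullet> gW v - W v)) (at 1)"
    unfolding g_def by (auto intro!: derivative_eq_intros)
  moreover have "v \<bullet> gW v - W v < 0" using \<open>\<not> W v \<le> v \<bullet> gW v\<close> by simp
  ultimately obtain d where d: "0 < d" "\<And>h. 0 < h \<Longrightarrow> h < d \<Longrightarrow> g 1 < g (1 - h)"
    using DERIV_neg_dec_left by blast
  \<comment> \<open>The bound \<open>1\<close> keeps \<open>1 - h\<close> in the range where
    \<open>W_scaled\<close> applies.\<close>
  define h where "h = min (d / 2) 1"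
  have "g 1 < g (1 - h)" using d by (auto simp: h_def)
  moreover have "g (1 - h) \<le> 0" using W_scaled[of "1 - h" v] d by (auto simp: g_def h_def)
  ultimately show False by (simp add: g_def)
qed

lemma K_coercive: obtains l where "0 < l" "\<And>v. l * (norm v)\<^sup>2 \<le> v \<bullet> K v"
proof -
  have "continuous_on (sphere 0 1) (\<lambda>v. v \<bullet> K v)"
    by (intro continuous_intros linear_continuous_on K_linear)
  moreover have "sphere (0::'a) 1 \<noteq> {}" by simp
  ultimately obtain w where w: "w \<in> sphere 0 1" "\<And>v. v \<in> sphere 0 1 \<Longrightarrow> w \<bullet> K w \<le> v \<bullet> K v"
    using continuous_attains_inf[OF compact_sphere, of 0 1 "\<lambda>v. v \<bullet> K v"] by blast
  show thesis
  proof (rule that[of "w \<bullet> K w"])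
    show "0 < w \<bullet> K w" using w by (intro K_pos) auto
    fix v :: 'a
    show "w \<bullet> K w * (norm v)\<^sup>2 \<le> v \<bullet> K v"
    proof (cases "v = 0")
      case False
      have "w \<bullet> K w \<le> (v /\<^sub>R norm v) \<bullet> K (v /\<^sub>R norm v)" using False by (intro w) auto
      also have "\<dots> = (v \<bullet> K v) / (norm v)\<^sup>2"
        by (simp add: linear_simps(5)[OF K_linear] power2_eq_square divide_inverse ac_simps)
      finally show ?thesis using False by (simp add: field_simps)
    qed (simp add: linear_simps[OF K_linear])
  qed
qed

text \<open>In the cross term, \<open>H_bound\<close> contributes the factor
  \<open>1 + norm v\<close>, which multiplies \<open>norm (gW v)\<close>; this product is what
  \<open>W_growth\<close> converts into \<open>W v + 1\<close>. The rate \<open>l\<close> comes from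
  \<open>K\<close> alone, only \<open>\<beta>\<close> depends on the bound for
  \<open>u\<close>.\<close>

lemma W_rate:
  obtains l where "0 < l" "\<And>r. 0 < r \<Longrightarrow> \<exists>\<beta>\<ge>0. \<forall>v u. norm u \<le> r \<longrightarrow>
     (- K (gW v + H v u)) \<bullet> gW v \<le> - l * (norm (gW v))\<^sup>2 + \<beta> * norm u * (W v + 1)"
proof -
  obtain l where l: "0 < l" "\<And>v. l * (norm v)\<^sup>2 \<le> v \<bullet> K v" using K_coercive by blast
  obtain k where k: "0 \<le> k" "\<And>v. norm (gW v) * (1 + norm v) \<le> k * (W v + 1)" using W_growth by blast
  show thesis
  proof (rule that[OF l(1)])
    fix r :: real assume "0 < r"
    then obtain \<kappa> where \<kappa>: "0 \<le> \<kappa>" "\<And>v u. norm u \<le> r \<Longrightarrow> norm (H v u) \<le> \<kappa> * norm u * (1 + norm v)"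
      using H_bound by blast
    define \<beta> where "\<beta> = onorm K * \<kappa> * k"
    have o: "0 \<le> onorm K" by (rule onorm_pos_le[OF K_linear])
    show "\<exists>\<beta>\<ge>0. \<forall>v u. norm u \<le> r \<longrightarrow>
      (- K (gW v + H v u)) \<bullet> gW v \<le> - l * (norm (gW v))\<^sup>2 + \<beta> * norm u * (W v + 1)"
    proof (intro exI[of _ \<beta>] conjI allI impI)
      show "0 \<le> \<beta>" using o \<kappa> k by (simp add: \<beta>_def)
      fix v u assume u: "norm (u::'b) \<le> r"
      have "- (K (H v u) \<bullet> gW v) \<le> norm (K (H v u)) * norm (gW v)"
        using norm_cauchy_schwarz[of "- K (H v u)" "gW v"] by simp
      also have "\<dots> \<le> (onorm K * norm (H v u)) * norm (gW v)"
        by (intro mult_right_mono onorm[OF K_linear]) auto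
      also have "\<dots> \<le> (onorm K * (\<kappa> * norm u * (1 + norm v))) * norm (gW v)"
        using o \<kappa>(2)[OF u] by (intro mult_right_mono mult_left_mono) auto
      also have "\<dots> = (onorm K * \<kappa> * norm u) * (norm (gW v) * (1 + norm v))" by (simp add: algebra_simps)
      also have "\<dots> \<le> (onorm K * \<kappa> * norm u) * (k * (W v + 1))"
        using o \<kappa> by (intro mult_left_mono k) auto
      finally have "- (K (H v u) \<bullet> gW v) \<le> \<beta> * norm u * (W v + 1)" by (simp add: \<beta>_def algebra_simps)
      moreover have "(- K (gW v + H v u)) \<bullet> gW v = - (gW v \<bullet> K (gW v)) - K (H v u) \<bullet> gW v"
        by (simp add: linear_simps(1)[OF K_linear] inner_diff_left inner_add_left inner_diff_right inner_commute)
      ultimately show "(- K (gW v + H v u)) \<bullet> gW v \<le> - l * (norm (gW v))\<^sup>2 + \<beta> * norm u * (W v + 1)"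
        using l(2)[of "gW v"] by linarith
    qed
  qed
qed

lemma snd_solves: "solves_on F I x \<Longrightarrow> solves_on A I (\<lambda>t. snd (x t))"
  unfolding solves_on_def F_def has_vector_derivative_def
  using has_derivative_snd by (fastforce simp: case_prod_unfold)

lemma W_deriv:
  assumes "solves_on F I x" "t \<in> I"
  shows "((\<lambda>t. W (fst (x t))) has_real_derivative
     (- K (gW (fst (x t)) + H (fst (x t)) (snd (x t)))) \<bullet> gW (fst (x t))) (at t within I)"
    (is "(_ has_real_derivative ?v' \<bullet> ?g) _")
proof -
  have "((\<lambda>t. fst (x t)) has_derivative (\<lambda>h. h *\<^sub>R ?v')) (at t within I)"
    using assms has_derivative_fst unfolding solves_on_def has_vector_derivative_def F_def
    by (fastforce simp: case_prod_unfold)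
  moreover have "(W has_derivative (\<lambda>h. h \<bullet> ?g)) (at (fst (x t)))"
    using W_gderiv by (simp add: gderiv_def)
  ultimately have "((\<lambda>t. W (fst (x t))) has_derivative (\<lambda>h. (h *\<^sub>R ?v') \<bullet> ?g)) (at t within I)"
    by (rule has_derivative_compose)
  then show ?thesis unfolding has_field_derivative_def
    by (rule has_derivative_eq_rhs) (simp add: fun_eq_iff)
qed

lemma snd_decay:
  "0 < T \<Longrightarrow> solves_on F {0..<T} x \<Longrightarrow> t \<in> {0..<T} \<Longrightarrow>
    norm (snd (x t)) \<le> c * exp (- \<alpha> * t) * norm (snd (x 0))"
  using A_decay[OF _ snd_solves] by blast

text \<open>Since \<open>u\<close> decays exponentially, \<open>\<integral> \<parallel>u\<parallel> \<le> c \<parallel>u(0)\<parallel> / \<alpha>\<close>, so that the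
  estimate \<open>W' \<le> \<beta> \<parallel>u\<parallel> (W + 1)\<close> only permits growth by a bounded factor.\<close>

lemma W_bound:
  assumes "0 < r"
  obtains \<gamma> where "0 \<le> \<gamma>" "\<And>T x t. 0 < T \<Longrightarrow> solves_on F {0..<T} x \<Longrightarrow> c * norm (snd (x 0)) \<le> r \<Longrightarrow>
     t \<in> {0..<T} \<Longrightarrow> W (fst (x t)) + 1 \<le> (W (fst (x 0)) + 1) * exp (\<gamma> * norm (snd (x 0)))"
proof -
  obtain l \<beta> where l: "0 < l" and \<beta>: "0 \<le> \<beta>" "\<And>v u. norm u \<le> r \<Longrightarrow>
     (- K (gW v + H v u)) \<bullet> gW v \<le> - l * (norm (gW v))\<^sup>2 + \<beta> * norm u * (W v + 1)"
    using W_rate \<open>0 < r\<close> by metis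
  show thesis
  proof (rule that[of "\<beta> * c / \<alpha>"])
    show "0 \<le> \<beta> * c / \<alpha>" using \<beta> c_pos \<alpha>_pos by simp
    fix T x t assume T: "0 < T" and x: "solves_on F {0..<T} x" and small: "c * norm (snd (x 0)) \<le> r"
      and t: "t \<in> {0..<T}"
    define n where "n = norm (snd (x 0))"
    \<comment> \<open>An integrating factor: the exponent is the integral over
      \<open>[t, \<infinity>)\<close> of the coefficient
      \<open>\<beta> c n exp (- \<alpha> s)\<close>. Hence \<open>w e\<close> does not increase,
      \<open>e\<close> is at least \<open>1\<close>, and \<open>e 0\<close> is the growth factor
      claimed.\<close>
    define e where "e t = exp (\<beta> * c / \<alpha> * n * exp (- \<alpha> * t))" for t
    define w where "w t = W (fst (x t)) + 1" for t
    define w' where "w' t = (- K (gW (fst (x t)) + H (fst (x t)) (snd (x t)))) \<bullet> gW (fst (x t))" for t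
    have w_pos: "0 < w t" for t using W_nonneg[of "fst (x t)"] by (simp add: w_def)
    have "w t * e t \<le> w 0 * e 0"
    proof (rule nonincreasing_if_deriv_nonpos_within[of "{0..<T}" "\<lambda>t. w t * e t"
          "\<lambda>t. (w' t - \<beta> * (c * exp (- \<alpha> * t) * n) * w t) * e t"])
      fix s assume s: "s \<in> {0..<T}"
      have "(e has_real_derivative - (\<beta> * (c * exp (- \<alpha> * s) * n)) * e s) (at s within {0..<T})"
        unfolding e_def using \<alpha>_pos by (auto intro!: derivative_eq_intros)
      moreover have "(w has_real_derivative w' s) (at s within {0..<T})"
        unfolding w_def w'_def by (rule derivative_eq_intros W_deriv[OF x s] | simp)+
      ultimately show "((\<lambda>t. w t * e t) has_real_derivative
          (w' s - \<beta> * (c * exp (- \<alpha> * s) * n) * w s) * e s) (at s within {0..<T})"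
        by (auto intro!: derivative_eq_intros simp: algebra_simps)
      have u: "norm (snd (x s)) \<le> c * exp (- \<alpha> * s) * n"
        unfolding n_def by (rule snd_decay[OF T x s])
      also have "\<dots> \<le> c * 1 * n"
        using s c_pos \<alpha>_pos by (intro mult_right_mono mult_left_mono) (auto simp: n_def)
      finally have "norm (snd (x s)) \<le> r" using small by (simp add: n_def)
      then have "w' s \<le> - l * (norm (gW (fst (x s))))\<^sup>2 + \<beta> * norm (snd (x s)) * w s"
        unfolding w_def w'_def by (rule \<beta>(2))
      also have "\<dots> \<le> \<beta> * norm (snd (x s)) * w s" using l by simp
      also have "\<dots> \<le> \<beta> * (c * exp (- \<alpha> * s) * n) * w s"
        using u \<beta>(1) w_pos[of s] by (intro mult_right_mono mult_left_mono) auto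
      finally show "(w' s - \<beta> * (c * exp (- \<alpha> * s) * n) * w s) * e s \<le> 0"
        by (simp add: e_def mult_nonpos_nonneg)
    qed (use t T in \<open>auto simp: is_interval_co\<close>)
    moreover have "1 \<le> e t" using \<beta>(1) c_pos \<alpha>_pos by (simp add: e_def n_def)
    ultimately have "w t \<le> w 0 * e 0"
      using w_pos[of t] mult_left_mono[of 1 "e t" "w t"] by linarith
    then show "W (fst (x t)) + 1 \<le> (W (fst (x 0)) + 1) * exp (\<beta> * c / \<alpha> * norm (snd (x 0)))"
      by (simp add: w_def e_def n_def)
  qed
qed

text \<open>\<open>W_bound\<close> limits \<open>W\<close>, and coercivity turns this into a bound
  on the first component. Both bounds depend on the initial state alone, neither on \<open>T\<close>
  nor on the solution, as continuation requires.\<close>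

lemma solution_bounds:
  obtains E B where "0 < B" "\<And>T x t. 0 < T \<Longrightarrow> solves_on F {0..<T} x \<Longrightarrow> x 0 = p \<Longrightarrow> t \<in> {0..<T} \<Longrightarrow>
     W (fst (x t)) \<le> E \<and> norm (fst (x t)) \<le> B"
proof -
  define r where "r = c * norm (snd p) + 1"
  have "0 < r" unfolding r_def using c_pos by (simp add: add_nonneg_pos)
  from W_bound[OF this] obtain \<gamma> where \<gamma>: "0 \<le> \<gamma>" "\<And>T x t. 0 < T \<Longrightarrow> solves_on F {0..<T} x \<Longrightarrow>
      c * norm (snd (x 0)) \<le> r \<Longrightarrow> t \<in> {0..<T} \<Longrightarrow>
      W (fst (x t)) + 1 \<le> (W (fst (x 0)) + 1) * exp (\<gamma> * norm (snd (x 0)))"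
    by blast
  obtain m where m: "0 < m" "\<And>v. 1 \<le> norm v \<Longrightarrow> m * norm v \<le> W v"
    using W_coercive[of 1] by auto
  define E where "E = (W (fst p) + 1) * exp (\<gamma> * norm (snd p))"
  show thesis
  proof (rule that[of "max 1 (E / m)" E])
    fix T x t assume *: "0 < T" "solves_on F {0..<T} x" "x 0 = p" "t \<in> {0..<T}"
    then have E: "W (fst (x t)) \<le> E"
      using \<gamma>(2)[of T x t] by (simp add: E_def r_def)
    moreover have "norm (fst (x t)) \<le> max 1 (E / m)"
    proof (cases "1 \<le> norm (fst (x t))")
      case True
      then have "norm (fst (x t)) \<le> E / m"
        using m E by (metis mult.commute order_trans pos_le_divide_eq)
      then show ?thesis by simp
    qed simp
    ultimately show "W (fst (x t)) \<le> E \<and> norm (fst (x t)) \<le> max 1 (E / m)" ..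
  qed simp
qed

lemma F_forward_complete: "forward_complete F"
proof (rule forward_complete_if_bounded[OF F_cont])
  fix p
  obtain E B where B: "\<And>T x t. 0 < T \<Longrightarrow> solves_on F {0..<T} x \<Longrightarrow> x 0 = p \<Longrightarrow> t \<in> {0..<T} \<Longrightarrow>
     W (fst (x t)) \<le> E \<and> norm (fst (x t)) \<le> B"
    using solution_bounds[of p] by metis
  show "\<exists>B. \<forall>T>0. \<forall>x. solves_on F {0..<T} x \<longrightarrow> x 0 = p \<longrightarrow> (\<forall>t\<in>{0..<T}. norm (x t) \<le> B)"
  proof (intro exI[of _ "B + c * norm (snd p)"] allI impI ballI)
    fix T x t assume *: "0 < T" "solves_on F {0..<T} x" "x 0 = p" "t \<in> {0..<T}"
    have "norm (snd (x t)) \<le> c * exp (- \<alpha> * t) * norm (snd p)" using snd_decay[of T x t] * by simp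
    also have "\<dots> \<le> c * 1 * norm (snd p)"
      using * c_pos \<alpha>_pos by (intro mult_right_mono mult_left_mono) auto
    finally have "norm (snd (x t)) \<le> c * norm (snd p)" by simp
    moreover have "norm (x t) \<le> norm (fst (x t)) + norm (snd (x t))"
      using norm_Pair_le[of "fst (x t)" "snd (x t)"] by simp
    ultimately show "norm (x t) \<le> B + c * norm (snd p)" using B[OF *] by linarith
  qed
qed

text \<open>\<open>W_bound\<close> estimates \<open>W + 1\<close> for all times by a continuous
  function \<open>e\<close> of the initial state with \<open>e 0 = 1\<close>. So \<open>W\<close>
  stays small, and coercivity at \<open>\<epsilon> / 2\<close> keeps the first component
  small.\<close>

lemma F_stable:
  assumes "0 < \<epsilon>"
  shows "\<exists>\<delta>>0. \<forall>x. solves_on F {0..} x \<longrightarrow> dist (x 0) 0 < \<delta> \<longrightarrow> (\<forall>t\<ge>0. dist (x t) 0 < \<epsilon>)"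
proof -
  obtain m where m: "0 < m" "\<And>v. \<epsilon> / 2 \<le> norm v \<Longrightarrow> m * norm v \<le> W v"
    using W_coercive[of "\<epsilon> / 2"] assms by auto
  obtain \<gamma> where \<gamma>: "0 \<le> \<gamma>" "\<And>T x t. 0 < T \<Longrightarrow> solves_on F {0..<T} x \<Longrightarrow>
      c * norm (snd (x 0)) \<le> 1 \<Longrightarrow> t \<in> {0..<T} \<Longrightarrow>
      W (fst (x t)) + 1 \<le> (W (fst (x 0)) + 1) * exp (\<gamma> * norm (snd (x 0)))"
    using W_bound[of 1] by auto
  define e where "e p = (W (fst p) + 1) * exp (\<gamma> * norm (snd p))" for p :: "'a \<times> 'b"
  have "continuous_on UNIV e" unfolding e_def
    by (intro continuous_intros continuous_on_compose2[OF W_cont[of UNIV]]) auto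
  then have "isCont e 0" using continuous_on_eq_continuous_at[OF open_UNIV, of e] by blast
  moreover have "e 0 = 1" by (simp add: e_def W_zero)
  ultimately obtain d where d: "0 < d" "\<And>p. norm p < d \<Longrightarrow> \<bar>e p - 1\<bar> < m * (\<epsilon> / 2)"
    using m assms unfolding continuous_at_eps_delta dist_norm
    by (metis diff_zero half_gt_zero mult_pos_pos real_norm_def)
  \<comment> \<open>The second entry serves two purposes: \<open>c norm (snd (x 0)) \<le> 1\<close>
    is required for \<open>\<gamma>\<close>, and \<open>c norm (snd (x 0)) < \<epsilon> / 2\<close>
    confines the linear component.\<close>
  define \<delta> where "\<delta> = min d (min 1 (\<epsilon> / 2) / c)"
  have "0 < \<delta>" using d c_pos assms by (simp add: \<delta>_def)
  moreover have "dist (x t) 0 < \<epsilon>"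
    if x: "solves_on F {0..} x" and x0: "dist (x 0) 0 < \<delta>" and t: "t \<ge> 0" for x t
  proof -
    have xT: "solves_on F {0..<t + 1} x" by (rule solves_on_subset[OF x]) auto
    have "norm (snd (x 0)) \<le> norm (x 0)" by (metis norm_snd_le prod.collapse)
    then have "norm (snd (x 0)) < min 1 (\<epsilon> / 2) / c" using x0 by (simp add: \<delta>_def)
    then have n: "c * norm (snd (x 0)) < min 1 (\<epsilon> / 2)" using c_pos by (simp add: field_simps)
    have "W (fst (x t)) + 1 \<le> e (x 0)" unfolding e_def
      by (rule \<gamma>(2)[OF _ xT]) (use n t in auto)
    also have "e (x 0) < 1 + m * (\<epsilon> / 2)" using d(2)[of "x 0"] x0 unfolding \<delta>_def abs_less_iff by simp
    finally have "W (fst (x t)) < m * (\<epsilon> / 2)" by simp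
    then have v: "norm (fst (x t)) < \<epsilon> / 2"
      using m(2)[of "fst (x t)"] mult_left_mono[of "\<epsilon> / 2" "norm (fst (x t))" m] m(1)
      by linarith
    have "norm (snd (x t)) \<le> c * exp (- \<alpha> * t) * norm (snd (x 0))" using snd_decay[OF _ xT, of t] t by simp
    also have "\<dots> \<le> c * 1 * norm (snd (x 0))"
      using t c_pos \<alpha>_pos by (intro mult_right_mono mult_left_mono) auto
    finally have "norm (snd (x t)) < \<epsilon> / 2" using n by simp
    then show ?thesis
      using v norm_Pair_le[of "fst (x t)" "snd (x t)"] by simp
  qed
  ultimately show ?thesis by blast
qed

text \<open>If \<open>W\<close> stayed above \<open>\<delta> / 2\<close> from some time on, then
  \<open>W v \<le> v \<bullet> gW v\<close> and boundedness of \<open>v\<close> would keep the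
  gradient away from \<open>0\<close>, so that the nonincreasing function \<open>y\<close> would
  become negative. Thus \<open>W\<close> is small at some late time, and monotonicity of
  \<open>y\<close> keeps it small afterwards.\<close>

lemma F_attractive:
  assumes x: "solves_on F {0..} x"
  shows "(x \<longlongrightarrow> 0) at_top"
proof -
  define n where "n = norm (snd (x 0))"
  have xT: "solves_on F {0..<T} x" for T by (rule solves_on_subset[OF x]) auto
  obtain E B where B: "0 < B" and "\<And>T y t. 0 < T \<Longrightarrow> solves_on F {0..<T} y \<Longrightarrow> y 0 = x 0 \<Longrightarrow> t \<in> {0..<T} \<Longrightarrow>
     W (fst (y t)) \<le> E \<and> norm (fst (y t)) \<le> B"
    using solution_bounds[of "x 0"] by metis
  from this(2)[OF _ xT refl] have EB: "W (fst (x t)) \<le> E" "norm (fst (x t)) \<le> B" if "0 \<le> t" for t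
    using that by (meson atLeastLessThan_iff less_add_one add_nonneg_pos zero_less_one)+
  have u: "norm (snd (x t)) \<le> c * exp (- \<alpha> * t) * n" if "0 \<le> t" for t
    using snd_decay[OF _ xT, of "t + 1" t] that by (simp add: n_def)
  define r where "r = c * n + 1"
  have "0 < r" unfolding r_def using c_pos by (simp add: add_nonneg_pos n_def)
  then obtain l \<beta> where l: "0 < l" and \<beta>: "0 \<le> \<beta>" "\<And>v u. norm u \<le> r \<Longrightarrow>
     (- K (gW v + H v u)) \<bullet> gW v \<le> - l * (norm (gW v))\<^sup>2 + \<beta> * norm u * (W v + 1)"
    using W_rate by metis
  define D where "D = \<beta> * (c * n) * (E + 1)"
  have E0: "0 \<le> E" using EB(1)[of 0] W_nonneg[of "fst (x 0)"] by linarith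
  have D: "0 \<le> D" using \<beta> c_pos E0 by (simp add: D_def n_def)
  define g where "g t = norm (gW (fst (x t)))" for t
  define w' where "w' t = (- K (gW (fst (x t)) + H (fst (x t)) (snd (x t)))) \<bullet> gW (fst (x t))" for t
  have w': "w' t \<le> - l * (g t)\<^sup>2 + D * exp (- \<alpha> * t)" if t: "0 \<le> t" for t
  proof -
    have "c * exp (- \<alpha> * t) * n \<le> c * 1 * n"
      using t c_pos \<alpha>_pos by (intro mult_right_mono mult_left_mono) (auto simp: n_def)
    then have "norm (snd (x t)) \<le> r" using u[OF t] by (simp add: r_def)
    then have "w' t \<le> - l * (g t)\<^sup>2 + \<beta> * norm (snd (x t)) * (W (fst (x t)) + 1)"
      unfolding w'_def g_def by (rule \<beta>(2))
    also have "\<beta> * norm (snd (x t)) * (W (fst (x t)) + 1) \<le> \<beta> * (c * exp (- \<alpha> * t) * n) * (E + 1)"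
      using u[OF t] EB(1)[OF t] \<beta>(1) c_pos W_nonneg[of "fst (x t)"]
      by (intro mult_mono mult_nonneg_nonneg) (auto simp: n_def)
    finally show ?thesis by (simp add: D_def algebra_simps)
  qed
  \<comment> \<open>The added term is the integral of the disturbance
    \<open>D exp (- \<alpha> s)\<close> over \<open>[t, \<infinity>)\<close>; its derivative cancels
    the disturbance, which leaves \<open>y' \<le> - l g\<^sup>2\<close>.\<close>
  define y where "y t = W (fst (x t)) + D / \<alpha> * exp (- \<alpha> * t)" for t
  have y_W: "W (fst (x t)) \<le> y t" for t using D \<alpha>_pos by (simp add: y_def)
  have y_deriv: "(y has_real_derivative w' t - D * exp (- \<alpha> * t)) (at t within {0..})" if t: "0 \<le> t" for t
  proof -
    have "((\<lambda>t. W (fst (x t))) has_real_derivative w' t) (at t within {0..})"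
      unfolding w'_def using W_deriv[OF x] t by simp
    then show ?thesis
      unfolding y_def using \<alpha>_pos by (auto intro!: derivative_eq_intros)
  qed
  have y_mono: "y t \<le> y s" if "0 \<le> s" "s \<le> t" for s t
  proof (rule nonincreasing_if_deriv_nonpos_within[of "{0..}" y "\<lambda>t. w' t - D * exp (- \<alpha> * t)"])
    fix t :: real assume t: "t \<in> {0..}"
    have "0 \<le> l * (g t)\<^sup>2" using l by simp
    then show "w' t - D * exp (- \<alpha> * t) \<le> 0" using w'[of t] t by simp
  qed (use that y_deriv in \<open>auto simp: is_interval_ci\<close>)
  have exp0: "((\<lambda>t. exp (- \<alpha> * t)) \<longlongrightarrow> 0) at_top"
    by (intro filterlim_compose[OF exp_at_bot]
        filterlim_tendsto_neg_mult_at_bot[OF tendsto_const _ filterlim_ident]) (use \<alpha>_pos in simp)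
  have W0: "\<forall>\<^sub>F t in at_top. W (fst (x t)) < \<delta>" if "0 < \<delta>" for \<delta>
  proof -
    have "((\<lambda>t. D / \<alpha> * exp (- \<alpha> * t)) \<longlongrightarrow> 0) at_top" by (rule tendsto_mult_right_zero[OF exp0])
    then have "\<forall>\<^sub>F t in at_top. D / \<alpha> * exp (- \<alpha> * t) < \<delta> / 2"
      by (rule order_tendstoD) (use that in simp)
    then obtain T where T: "0 \<le> T" "\<And>t. T \<le> t \<Longrightarrow> D / \<alpha> * exp (- \<alpha> * t) < \<delta> / 2"
      unfolding eventually_at_top_linorder by (meson max.cobounded1 max.cobounded2 max.boundedE)
    have "\<exists>t1\<ge>T. W (fst (x t1)) < \<delta> / 2"
    proof (rule ccontr)
      assume "\<not> (\<exists>t1\<ge>T. W (fst (x t1)) < \<delta> / 2)"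
      then have ge: "\<delta> / 2 \<le> W (fst (x t))" if "T \<le> t" for t using that by (meson not_less)
      define \<eta> where "\<eta> = l * (\<delta> / 2 / B)\<^sup>2"
      have "0 < \<eta>" using l B \<open>0 < \<delta>\<close> by (simp add: \<eta>_def)
      have \<eta>: "\<eta> \<le> l * (g t)\<^sup>2" if t: "T \<le> t" for t
      proof -
        have "\<delta> / 2 \<le> fst (x t) \<bullet> gW (fst (x t))"
          using ge[OF t] W_le_inner_gW[of "fst (x t)"] by linarith
        also have "\<dots> \<le> norm (fst (x t)) * g t" unfolding g_def by (rule norm_cauchy_schwarz)
        also have "\<dots> \<le> B * g t" using EB(2)[of t] t T by (intro mult_right_mono) (auto simp: g_def)
        finally have "\<delta> / 2 / B \<le> g t" using B by (simp add: field_simps)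
        then show ?thesis unfolding \<eta>_def using \<open>0 < \<delta>\<close> B l
          by (intro mult_left_mono power_mono) auto
      qed
      \<comment> \<open>By this time a decrease at rate \<open>\<eta>\<close> has consumed
        \<open>y T\<close> and a further \<open>\<eta>\<close>, so
        \<open>y t \<le> - \<eta>\<close>.\<close>
      define t where "t = T + y T / \<eta> + 1"
      have "0 \<le> y T" using y_W[of T] W_nonneg[of "fst (x T)"] by linarith
      then have tT: "T \<le> t" using \<open>0 < \<eta>\<close> by (simp add: t_def)
      have "y t + \<eta> * t \<le> y T + \<eta> * T"
      proof (rule nonincreasing_if_deriv_nonpos_within[of "{T..}" "\<lambda>t. y t + \<eta> * t"
            "\<lambda>t. w' t - D * exp (- \<alpha> * t) + \<eta>"])
        fix t assume t: "t \<in> {T..}"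
        have "(y has_real_derivative w' t - D * exp (- \<alpha> * t)) (at t within {T..})"
          by (rule DERIV_subset[OF y_deriv]) (use t T in auto)
        then show "((\<lambda>t. y t + \<eta> * t) has_real_derivative w' t - D * exp (- \<alpha> * t) + \<eta>) (at t within {T..})"
          by (auto intro!: derivative_eq_intros)
        show "w' t - D * exp (- \<alpha> * t) + \<eta> \<le> 0" using w'[of t] \<eta>[of t] t T by auto
      qed (use tT in \<open>auto simp: is_interval_ci\<close>)
      moreover have "\<eta> * t = \<eta> * T + y T + \<eta>" using \<open>0 < \<eta>\<close> by (simp add: t_def algebra_simps)
      moreover have "0 \<le> y t" using y_W[of t] W_nonneg[of "fst (x t)"] by linarith
      ultimately show False using \<open>0 < \<eta>\<close> by linarith
    qed
    then obtain t1 where t1: "T \<le> t1" "W (fst (x t1)) < \<delta> / 2" by blast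
    have "W (fst (x t)) < \<delta>" if "t1 \<le> t" for t
    proof -
      have "W (fst (x t)) \<le> y t1" using y_W[of t] y_mono[of t1 t] that t1 T by linarith
      also have "\<dots> < \<delta>" using T(2)[OF t1(1)] t1(2) unfolding y_def by linarith
      finally show ?thesis .
    qed
    then show ?thesis unfolding eventually_at_top_linorder by blast
  qed
  have "((\<lambda>t. fst (x t)) \<longlongrightarrow> 0) at_top"
  proof (rule tendstoI)
    fix \<epsilon> :: real assume "0 < \<epsilon>"
    then obtain m where m: "0 < m" "\<And>v. \<epsilon> \<le> norm v \<Longrightarrow> m * norm v \<le> W v" using W_coercive by blast
    have "0 < m * \<epsilon>" using m \<open>0 < \<epsilon>\<close> by simp
    from W0[OF this] show "\<forall>\<^sub>F t in at_top. dist (fst (x t)) 0 < \<epsilon>"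
    proof (rule eventually_mono)
      fix t assume "W (fst (x t)) < m * \<epsilon>"
      then have "norm (fst (x t)) < \<epsilon>"
        using m(2)[of "fst (x t)"] mult_left_mono[of \<epsilon> "norm (fst (x t))" m] m(1)
        by linarith
      then show "dist (fst (x t)) 0 < \<epsilon>" by simp
    qed
  qed
  moreover have "((\<lambda>t. snd (x t)) \<longlongrightarrow> 0) at_top"
  proof (rule Lim_null_comparison)
    show "\<forall>\<^sub>F t in at_top. norm (snd (x t)) \<le> c * n * exp (- \<alpha> * t)"
      using eventually_ge_at_top[of 0] by (rule eventually_mono) (use u in \<open>simp add: algebra_simps\<close>)
    show "((\<lambda>t. c * n * exp (- \<alpha> * t)) \<longlongrightarrow> 0) at_top" by (rule tendsto_mult_right_zero[OF exp0])
  qed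
  ultimately have "((\<lambda>t. (fst (x t), snd (x t))) \<longlongrightarrow> (0, 0)) at_top" by (rule tendsto_Pair)
  then show ?thesis by (simp add: zero_prod_def)
qed

lemma F_zero: "F 0 = 0"
proof -
  obtain \<kappa> where "\<And>v u. norm u \<le> 1 \<Longrightarrow> norm (H v u) \<le> \<kappa> * norm u * (1 + norm v)"
    using H_bound[of 1] by auto
  from this[of 0 0] have "H 0 0 = 0" by simp
  then show ?thesis
    using linear_simps(3)[OF K_linear] linear_simps(3)[OF A_linear]
    by (simp add: F_def zero_prod_def gW_zero)
qed

lemma F_gas: "globally_asymptotically_stable F 0"
  unfolding globally_asymptotically_stable_def
  using F_zero F_forward_complete F_stable F_attractive by blast

end

section \<open>The linear block\<close>

text \<open>Without the cross term \<open>\<epsilon> q x\<close>, the energy only satisfies \<open>V' = - kd \<sigma>\<^sup>2 - a q\<^sup>2 / C\<close>; the cross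
  term adds the missing negative multiple of \<open>x\<^sup>2\<close>.\<close>

lemma linear_block_quadratic_forms:
  fixes L C a kd ki :: real
  assumes "0 < L" "0 < C" "0 < a" "0 < kd" "0 < ki"
  obtains \<epsilon> m M \<mu> where "0 < m" "0 < M" "0 < \<mu>"
    "\<And>\<sigma> q x. m * (\<sigma>\<^sup>2 + q\<^sup>2 + x\<^sup>2) \<le> (L * \<sigma>\<^sup>2 + q\<^sup>2 / C + x\<^sup>2 / ki) / 2 + \<epsilon> * (q * x)"
    "\<And>\<sigma> q x. (L * \<sigma>\<^sup>2 + q\<^sup>2 / C + x\<^sup>2 / ki) / 2 + \<epsilon> * (q * x) \<le> M * (\<sigma>\<^sup>2 + q\<^sup>2 + x\<^sup>2)"
    "\<And>\<sigma> q x. - kd * \<sigma>\<^sup>2 - a * q\<^sup>2 / C + \<epsilon> * (\<sigma> * x - x\<^sup>2 - a * (q * x) + ki * q\<^sup>2 / C)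
       \<le> - \<mu> * (\<sigma>\<^sup>2 + q\<^sup>2 + x\<^sup>2)"
proof -
  \<comment> \<open>The first two bounds let the positive \<open>\<sigma>\<^sup>2\<close> and
    \<open>q\<^sup>2\<close> terms created by the cross term use at most half of the dissipation.
    The last two keep the cross term below half of the energy in \<open>q\<close> and
    \<open>x\<close>.\<close>
  define \<epsilon> where "\<epsilon> = Min {kd / 2, (a / (2 * C)) / (a\<^sup>2 + ki / C), 1 / (2 * C), 1 / (2 * ki)}"
  have e: "0 < \<epsilon>" using assms by (simp add: \<epsilon>_def add_pos_pos)
  have e1: "\<epsilon> \<le> kd / 2" and e3: "\<epsilon> \<le> 1 / (2 * C)" and e4: "\<epsilon> \<le> 1 / (2 * ki)"
    and "\<epsilon> \<le> (a / (2 * C)) / (a\<^sup>2 + ki / C)"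
    unfolding \<epsilon>_def by (intro Min_le; simp)+
  moreover have "0 < a\<^sup>2 + ki / C" using assms by (simp add: add_pos_pos)
  ultimately have e2: "\<epsilon> * (a\<^sup>2 + ki / C) \<le> a / (2 * C)"
    using pos_le_divide_eq by blast
  have cross: "\<bar>\<epsilon> * (q * x)\<bar> \<le> (q\<^sup>2 / C + x\<^sup>2 / ki) / 4" for q x
  proof -
    have "2 * \<bar>q * x\<bar> \<le> q\<^sup>2 + x\<^sup>2"
      using sum_squares_bound[of "\<bar>q\<bar>" "\<bar>x\<bar>"] by (simp add: abs_mult)
    then have "\<epsilon> * \<bar>q * x\<bar> \<le> \<epsilon> * ((q\<^sup>2 + x\<^sup>2) / 2)" using e by (intro mult_left_mono) auto
    also have "\<dots> = (\<epsilon> * q\<^sup>2 + \<epsilon> * x\<^sup>2) / 2" by (simp add: algebra_simps)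
    also have "\<dots> \<le> (1 / (2 * C) * q\<^sup>2 + 1 / (2 * ki) * x\<^sup>2) / 2"
      using mult_right_mono[OF e3, of "q\<^sup>2"] mult_right_mono[OF e4, of "x\<^sup>2"] by simp
    finally show ?thesis using e by (simp add: abs_mult)
  qed
  define m where "m = Min {L, 1 / C, 1 / ki} / 4"
  define M where "M = Max {L, 1 / C, 1 / ki}"
  define \<mu> where "\<mu> = Min {kd / 2, a / (2 * C), \<epsilon> / 2}"
  show thesis
  proof (rule that[of m M \<mu> \<epsilon>])
    show "0 < m" "0 < \<mu>" using assms e by (auto simp: m_def \<mu>_def)
    show "0 < M" using assms by (simp add: M_def less_max_iff_disj)
    fix \<sigma> q x :: real
    have "m \<le> L / 4" "m \<le> 1 / C / 4" "m \<le> 1 / ki / 4"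
      unfolding m_def by (auto intro!: divide_right_mono Min_le)
    note * = this[THEN mult_right_mono, OF zero_le_power2]
    have "m * \<sigma>\<^sup>2 \<le> L * \<sigma>\<^sup>2 / 4" "m * q\<^sup>2 \<le> q\<^sup>2 / C / 4" "m * x\<^sup>2 \<le> x\<^sup>2 / ki / 4"
      using *(1)[of \<sigma>] *(2)[of q] *(3)[of x] by simp_all
    moreover have "0 \<le> L * \<sigma>\<^sup>2" using assms by simp
    moreover have "A + B + D \<le> S / 2 + X / 2 + Y / 2 + Z"
      if "A \<le> S / 4" "B \<le> X / 4" "D \<le> Y / 4" "0 \<le> S" "- Z \<le> X / 4 + Y / 4" for A B D S X Y Z :: real
      using that by linarith
    ultimately show "m * (\<sigma>\<^sup>2 + q\<^sup>2 + x\<^sup>2) \<le> (L * \<sigma>\<^sup>2 + q\<^sup>2 / C + x\<^sup>2 / ki) / 2 + \<epsilon> * (q * x)"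
      using abs_le_D2[OF cross[of q x]] unfolding distrib_left add_divide_distrib by blast
    have "L \<le> M" "1 / C \<le> M" "1 / ki \<le> M" unfolding M_def by (auto intro!: Max_ge)
    note * = this[THEN mult_right_mono, OF zero_le_power2]
    have "L * \<sigma>\<^sup>2 \<le> M * \<sigma>\<^sup>2" "q\<^sup>2 / C \<le> M * q\<^sup>2" "x\<^sup>2 / ki \<le> M * x\<^sup>2"
      using *(1)[of \<sigma>] *(2)[of q] *(3)[of x] by simp_all
    moreover have "0 \<le> L * \<sigma>\<^sup>2" "0 \<le> q\<^sup>2 / C" "0 \<le> x\<^sup>2 / ki" using assms by simp_all
    moreover have "A / 2 + B / 2 + D / 2 + Z \<le> S + X + Y"
      if "A \<le> S" "B \<le> X" "D \<le> Y" "0 \<le> A" "0 \<le> B" "0 \<le> D" "Z \<le> B / 4 + D / 4" for A B D S X Y Z :: real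
      using that by linarith
    ultimately show "(L * \<sigma>\<^sup>2 + q\<^sup>2 / C + x\<^sup>2 / ki) / 2 + \<epsilon> * (q * x) \<le> M * (\<sigma>\<^sup>2 + q\<^sup>2 + x\<^sup>2)"
      using abs_le_D1[OF cross[of q x]] unfolding distrib_left add_divide_distrib by blast
    \<comment> \<open>Young's inequality, weighted so that each mixed product costs
      \<open>x\<^sup>2 / 4\<close> and half of \<open>- x\<^sup>2\<close> survives.\<close>
    have "0 \<le> (x / 2 - \<sigma>)\<^sup>2" "0 \<le> (x / 2 + a * q)\<^sup>2" by simp_all
    then have "\<sigma> * x - x\<^sup>2 - a * (q * x) + ki * q\<^sup>2 / C \<le> \<sigma>\<^sup>2 - x\<^sup>2 / 2 + (a\<^sup>2 + ki / C) * q\<^sup>2"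
      by (simp add: power2_eq_square algebra_simps)
    then have "\<epsilon> * (\<sigma> * x - x\<^sup>2 - a * (q * x) + ki * q\<^sup>2 / C) \<le> \<epsilon> * (\<sigma>\<^sup>2 - x\<^sup>2 / 2 + (a\<^sup>2 + ki / C) * q\<^sup>2)"
      using e by (intro mult_left_mono) auto
    also have "\<dots> = \<epsilon> * \<sigma>\<^sup>2 - \<epsilon> / 2 * x\<^sup>2 + \<epsilon> * (a\<^sup>2 + ki / C) * q\<^sup>2" by (simp add: algebra_simps)
    also have "\<dots> \<le> kd / 2 * \<sigma>\<^sup>2 - \<epsilon> / 2 * x\<^sup>2 + a / (2 * C) * q\<^sup>2"
      using mult_right_mono[OF e1, of "\<sigma>\<^sup>2"] mult_right_mono[OF e2, of "q\<^sup>2"] by simp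
    finally have 1: "\<epsilon> * (\<sigma> * x - x\<^sup>2 - a * (q * x) + ki * q\<^sup>2 / C) \<le> kd / 2 * \<sigma>\<^sup>2 - \<epsilon> / 2 * x\<^sup>2 + a / (2 * C) * q\<^sup>2" .
    have "\<mu> \<le> kd / 2" "\<mu> \<le> a / (2 * C)" "\<mu> \<le> \<epsilon> / 2" unfolding \<mu>_def by (auto intro!: Min_le)
    then have "\<mu> * \<sigma>\<^sup>2 \<le> kd / 2 * \<sigma>\<^sup>2" "\<mu> * q\<^sup>2 \<le> a / (2 * C) * q\<^sup>2" "\<mu> * x\<^sup>2 \<le> \<epsilon> / 2 * x\<^sup>2"
      by (auto simp only: intro!: mult_right_mono zero_le_power2)
    moreover have "a * q\<^sup>2 / C = 2 * (a / (2 * C) * q\<^sup>2)" by simp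
    moreover have "- \<mu> * (\<sigma>\<^sup>2 + q\<^sup>2 + x\<^sup>2) = - (\<mu> * \<sigma>\<^sup>2) - \<mu> * q\<^sup>2 - \<mu> * x\<^sup>2" by (simp add: algebra_simps)
    ultimately show "- kd * \<sigma>\<^sup>2 - a * q\<^sup>2 / C + \<epsilon> * (\<sigma> * x - x\<^sup>2 - a * (q * x) + ki * q\<^sup>2 / C)
       \<le> - \<mu> * (\<sigma>\<^sup>2 + q\<^sup>2 + x\<^sup>2)" using 1 by linarith
  qed
qed

text \<open>The corrected energy \<open>V\<close> lies between \<open>m\<close> and \<open>M\<close>
  times the squared norm, and \<open>V' \<le> - (\<mu> / M) V\<close>. Taking square roots halves
  the rate and gives the overshoot \<open>sqrt (M / m)\<close>. In the application \<open>L\<close>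
  is the total parallel inductance and \<open>a = 1 / (R C)\<close>.\<close>

lemma linear_block_decay:
  fixes L C a kd ki :: real
  assumes "0 < L" "0 < C" "0 < a" "0 < kd" "0 < ki"
  obtains c \<alpha> where "0 < c" "0 < \<alpha>"
    "\<And>T u t. 0 < T \<Longrightarrow> solves_on (\<lambda>(\<sigma>, q, x). ((- q / C - kd * \<sigma>) / L, \<sigma> - x - a * q, ki * q / C)) {0..<T} u \<Longrightarrow>
       t \<in> {0..<T} \<Longrightarrow> norm (u t) \<le> c * exp (- \<alpha> * t) * norm (u 0)"
proof -
  obtain \<epsilon> m M \<mu> where pos: "0 < m" "0 < M" "0 < \<mu>"
    and lower: "\<And>\<sigma> q x. m * (\<sigma>\<^sup>2 + q\<^sup>2 + x\<^sup>2) \<le> (L * \<sigma>\<^sup>2 + q\<^sup>2 / C + x\<^sup>2 / ki) / 2 + \<epsilon> * (q * x)"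
    and upper: "\<And>\<sigma> q x. (L * \<sigma>\<^sup>2 + q\<^sup>2 / C + x\<^sup>2 / ki) / 2 + \<epsilon> * (q * x) \<le> M * (\<sigma>\<^sup>2 + q\<^sup>2 + x\<^sup>2)"
    and rate: "\<And>\<sigma> q x. - kd * \<sigma>\<^sup>2 - a * q\<^sup>2 / C + \<epsilon> * (\<sigma> * x - x\<^sup>2 - a * (q * x) + ki * q\<^sup>2 / C)
       \<le> - \<mu> * (\<sigma>\<^sup>2 + q\<^sup>2 + x\<^sup>2)"
    using linear_block_quadratic_forms[OF assms] by metis
  define \<alpha> where "\<alpha> = \<mu> / (2 * M)"
  show thesis
  proof (rule that[of "sqrt (M / m)" \<alpha>])
    show "0 < sqrt (M / m)" "0 < \<alpha>" using pos by (simp_all add: \<alpha>_def)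
    fix T u t
    assume T: "0 < T" and u: "solves_on (\<lambda>(\<sigma>, q, x). ((- q / C - kd * \<sigma>) / L, \<sigma> - x - a * q, ki * q / C)) {0..<T} u"
      and t: "t \<in> {0..<T}"
    define \<sigma> q x where "\<sigma> t = fst (u t)" and "q t = fst (snd (u t))" and "x t = snd (snd (u t))" for t
    have u_eq: "u t = (\<sigma> t, q t, x t)" for t by (simp add: \<sigma>_def q_def x_def)
    have norm_u: "(norm (u t))\<^sup>2 = (\<sigma> t)\<^sup>2 + (q t)\<^sup>2 + (x t)\<^sup>2" for t
      by (simp add: u_eq norm_Pair)
    define V where "V t = (L * (\<sigma> t)\<^sup>2 + (q t)\<^sup>2 / C + (x t)\<^sup>2 / ki) / 2 + \<epsilon> * (q t * x t)" for t
    define V' where "V' t = - kd * (\<sigma> t)\<^sup>2 - a * (q t)\<^sup>2 / C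
      + \<epsilon> * (\<sigma> t * x t - (x t)\<^sup>2 - a * (q t * x t) + ki * (q t)\<^sup>2 / C)" for t
    have V: "m * (norm (u t))\<^sup>2 \<le> V t" "V t \<le> M * (norm (u t))\<^sup>2" for t
      unfolding norm_u V_def by (rule lower, rule upper)
    have V': "V' t \<le> - 2 * \<alpha> * V t" for t
    proof -
      have "2 * \<alpha> * V t \<le> 2 * \<alpha> * (M * (norm (u t))\<^sup>2)"
        using V(2)[of t] pos by (intro mult_left_mono) (auto simp: \<alpha>_def)
      also have "\<dots> = \<mu> * (norm (u t))\<^sup>2" using pos by (simp add: \<alpha>_def)
      finally show ?thesis using rate[of "\<sigma> t" "q t" "x t"] unfolding V'_def norm_u by simp
    qed
    have deriv: "(V has_real_derivative V' s) (at s within {0..<T})" if s: "s \<in> {0..<T}" for s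
    proof -
      have "(u has_derivative (\<lambda>h. h *\<^sub>R ((- q s / C - kd * \<sigma> s) / L, \<sigma> s - x s - a * q s, ki * q s / C)))
         (at s within {0..<T})"
        using u s by (auto simp: solves_on_def has_vector_derivative_def u_eq)
      note d = has_derivative_fst[OF this] has_derivative_fst[OF has_derivative_snd[OF this]]
        has_derivative_snd[OF has_derivative_snd[OF this]]
      have d1: "(\<sigma> has_real_derivative (- q s / C - kd * \<sigma> s) / L) (at s within {0..<T})"
        unfolding \<sigma>_def has_field_derivative_def
        by (rule has_derivative_eq_rhs[OF d(1)]) (auto simp: \<sigma>_def)
      have d2: "(q has_real_derivative \<sigma> s - x s - a * q s) (at s within {0..<T})"
        unfolding q_def has_field_derivative_def
        by (rule has_derivative_eq_rhs[OF d(2)]) (auto simp: q_def)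
      have d3: "(x has_real_derivative ki * q s / C) (at s within {0..<T})"
        unfolding x_def has_field_derivative_def
        by (rule has_derivative_eq_rhs[OF d(3)]) (auto simp: x_def)
      have "V = (\<lambda>t. (L * (\<sigma> t * \<sigma> t) + q t * q t / C + x t * x t / ki) / 2 + \<epsilon> * (q t * x t))"
        by (simp add: V_def fun_eq_iff power2_eq_square)
      moreover have "((\<lambda>t. (L * (\<sigma> t * \<sigma> t) + q t * q t / C + x t * x t / ki) / 2 + \<epsilon> * (q t * x t))
          has_real_derivative V' s) (at s within {0..<T})"
        by (rule DERIV_cong[OF DERIV_add[OF DERIV_cdivide[OF DERIV_add[OF DERIV_add[OF
          DERIV_cmult[OF DERIV_mult[OF d1 d1]] DERIV_cdivide[OF DERIV_mult[OF d2 d2]]]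
          DERIV_cdivide[OF DERIV_mult[OF d3 d3]]]] DERIV_cmult[OF DERIV_mult[OF d2 d3]]]])
          (use assms in \<open>simp add: V'_def field_simps power2_eq_square\<close>)
      ultimately show ?thesis by simp
    qed
    have "V t * exp (2 * \<alpha> * t) \<le> V 0 * exp (2 * \<alpha> * 0)"
    proof (rule nonincreasing_if_deriv_nonpos_within[of "{0..<T}" "\<lambda>t. V t * exp (2 * \<alpha> * t)"
          "\<lambda>t. (V' t + 2 * \<alpha> * V t) * exp (2 * \<alpha> * t)"])
      fix s assume s: "s \<in> {0..<T}"
      show "((\<lambda>t. V t * exp (2 * \<alpha> * t)) has_real_derivative (V' s + 2 * \<alpha> * V s) * exp (2 * \<alpha> * s)) (at s within {0..<T})"
        by (rule derivative_eq_intros deriv[OF s] refl)+ (simp add: algebra_simps)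
      show "(V' s + 2 * \<alpha> * V s) * exp (2 * \<alpha> * s) \<le> 0"
        using V'[of s] by (intro mult_nonpos_nonneg) auto
    qed (use t T in \<open>auto simp: is_interval_co\<close>)
    then have "V t * exp (2 * \<alpha> * t) \<le> M * (norm (u 0))\<^sup>2" using V(2)[of 0] by simp
    then have "m * (norm (u t))\<^sup>2 * exp (2 * \<alpha> * t) \<le> M * (norm (u 0))\<^sup>2"
      using mult_right_mono[OF V(1)[of t], of "exp (2 * \<alpha> * t)", OF exp_ge_zero] by linarith
    then have "(norm (u t))\<^sup>2 \<le> M / m * exp (- (2 * \<alpha> * t)) * (norm (u 0))\<^sup>2"
      using pos by (simp add: exp_minus field_simps)
    also have "\<dots> = (sqrt (M / m) * exp (- \<alpha> * t) * norm (u 0))\<^sup>2"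
    proof -
      have "(sqrt (M / m))\<^sup>2 = M / m" using pos by simp
      moreover have "(exp (- \<alpha> * t))\<^sup>2 = exp (- (2 * \<alpha> * t))"
        using exp_double[of "- \<alpha> * t"] by (simp add: mult.assoc)
      ultimately show ?thesis by (simp only: power_mult_distrib)
    qed
    finally show "norm (u t) \<le> sqrt (M / m) * exp (- \<alpha> * t) * norm (u 0)"
      by (rule power2_le_imp_le) (use pos in simp)
  qed
qed

section \<open>Change of coordinates\<close>

text \<open>The map \<open>A (x - p)\<close> carries the solutions of \<open>F\<close> onto those of
  \<open>G\<close>, and \<open>B\<close> leads back. Both directions are used, since existence is
  pulled back while stability concerns every solution. Operator bounds of \<open>A\<close> and
  \<open>B\<close> rescale \<open>\<delta>\<close> and \<open>\<epsilon>\<close>.\<close>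

lemma gas_affine_transport:
  fixes F :: "'a::real_normed_vector \<Rightarrow> 'a" and G :: "'b::real_normed_vector \<Rightarrow> 'b"
  assumes A: "bounded_linear A" and B: "bounded_linear B"
    and BA: "\<And>x. B (A x) = x" and AB: "\<And>y. A (B y) = y"
    and conj: "\<And>x. A (F x) = G (A (x - p))"
    and gas: "globally_asymptotically_stable G 0"
  shows "globally_asymptotically_stable F p"
proof -
  note simps = linear_simps[OF A] linear_simps[OF B]
  have to: "solves_on G I (\<lambda>t. A (x t - p))" if "solves_on F I x" for I x
    unfolding solves_on_def
  proof
    fix t assume "t \<in> I"
    then have "((\<lambda>t. x t - p) has_vector_derivative F (x t)) (at t within I)"
      using that by (auto simp: solves_on_def intro!: derivative_eq_intros)
    from bounded_linear.has_vector_derivative[OF A this]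
    show "((\<lambda>t. A (x t - p)) has_vector_derivative G (A (x t - p))) (at t within I)" by (simp add: conj)
  qed
  have from_G: "solves_on F I (\<lambda>t. p + B (y t))" if "solves_on G I y" for I y
    unfolding solves_on_def
  proof
    fix t assume "t \<in> I"
    then have "(y has_vector_derivative G (y t)) (at t within I)" using that by (simp add: solves_on_def)
    from bounded_linear.has_vector_derivative[OF B this]
    have "((\<lambda>t. p + B (y t)) has_vector_derivative B (G (y t))) (at t within I)"
      by (auto intro!: derivative_eq_intros)
    moreover have "B (G (y t)) = F (p + B (y t))" using conj[of "p + B (y t)"] BA AB by (metis add_diff_cancel_left')
    ultimately show "((\<lambda>t. p + B (y t)) has_vector_derivative F (p + B (y t))) (at t within I)" by simp
  qed
  have "F p = 0"
  proof -
    have "A (F p) = 0" using conj[of p] gas by (simp add: simps globally_asymptotically_stable_def)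
    then show ?thesis using BA[of "F p"] by (simp add: simps)
  qed
  moreover have "forward_complete F"
    unfolding forward_complete_def
  proof (intro conjI allI impI)
    fix z
    obtain y where "solves_on G {0..} y" "y 0 = A (z - p)"
      using gas unfolding globally_asymptotically_stable_def forward_complete_def by blast
    then show "\<exists>x. solves_on F {0..} x \<and> x 0 = z"
      using from_G BA by (intro exI[of _ "\<lambda>t. p + B (y t)"]) simp
  next
    fix T :: real and x assume T: "0 < T" and x: "solves_on F {0..<T} x"
    obtain y where y: "solves_on G {0..} y" "\<forall>t\<in>{0..<T}. y t = A (x t - p)"
      using gas T to[OF x] unfolding globally_asymptotically_stable_def forward_complete_def by metis
    show "\<exists>y. solves_on F {0..} y \<and> (\<forall>t\<in>{0..<T}. y t = x t)"
      using from_G[OF y(1)] y(2) BA by (intro exI[of _ "\<lambda>t. p + B (y t)"]) simp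
  qed
  moreover have "\<exists>\<delta>>0. \<forall>x. solves_on F {0..} x \<longrightarrow> dist (x 0) p < \<delta> \<longrightarrow> (\<forall>t\<ge>0. dist (x t) p < \<epsilon>)"
    if "0 < \<epsilon>" for \<epsilon>
  proof -
    obtain a where a: "0 < a" "\<And>x. norm (A x) \<le> norm x * a" using bounded_linear.pos_bounded[OF A] by blast
    obtain b where b: "0 < b" "\<And>x. norm (B x) \<le> norm x * b" using bounded_linear.pos_bounded[OF B] by blast
    have "0 < \<epsilon> / b" using b \<open>0 < \<epsilon>\<close> by simp
    then obtain \<delta> where \<delta>: "0 < \<delta>" "\<And>y t. solves_on G {0..} y \<Longrightarrow> dist (y 0) 0 < \<delta> \<Longrightarrow> 0 \<le> t \<Longrightarrow> dist (y t) 0 < \<epsilon> / b"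
      using gas unfolding globally_asymptotically_stable_def by blast
    have "dist (x t) p < \<epsilon>" if x: "solves_on F {0..} x" "dist (x 0) p < \<delta> / a" and t: "0 \<le> t" for x t
    proof -
      have "norm (A (x 0 - p)) \<le> norm (x 0 - p) * a" by (rule a)
      also have "\<dots> < \<delta>" using x(2) a(1) by (simp add: dist_norm pos_less_divide_eq)
      finally have "dist (A (x t - p)) 0 < \<epsilon> / b" using \<delta>(2)[OF to[OF x(1)] _ t] by simp
      then have "norm (A (x t - p)) * b < \<epsilon>" using b(1) by (simp add: pos_less_divide_eq)
      then show ?thesis using b(2)[of "A (x t - p)"] by (simp add: BA dist_norm)
    qed
    then show ?thesis using \<delta>(1) a(1) by (intro exI[of _ "\<delta> / a"]) auto
  qed
  moreover have "(x \<longlongrightarrow> p) at_top" if x: "solves_on F {0..} x" for x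
  proof -
    have "((\<lambda>t. A (x t - p)) \<longlongrightarrow> 0) at_top"
      using gas to[OF x] unfolding globally_asymptotically_stable_def by blast
    from bounded_linear.tendsto[OF B this] have "((\<lambda>t. x t - p) \<longlongrightarrow> 0) at_top" by (simp add: BA simps)
    then show ?thesis by (rule LIM_zero_cancel)
  qed
  ultimately show ?thesis unfolding globally_asymptotically_stable_def by blast
qed

text \<open>An equilibrium is a constant solution, which must be attracted by
  \<open>p\<close>.\<close>

lemma gas_unique_equilibrium:
  assumes gas: "globally_asymptotically_stable F p" and "F z = 0"
  shows "z = p"
proof -
  have "solves_on F {0..} (\<lambda>_. z)" using \<open>F z = 0\<close> by (simp add: solves_on_def)
  then have "((\<lambda>_::real. z) \<longlongrightarrow> p) at_top" using gas unfolding globally_asymptotically_stable_def by blast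
  then show ?thesis by (simp add: tendsto_const_iff)
qed

section \<open>Appended entries, block matrices and inverses\<close>

lemma sum_UNIV_plus_1: "(\<Sum>i\<in>UNIV. f i) = (\<Sum>k\<in>UNIV. f (Inl k)) + f (Inr (1::1))"
  for f :: "'p::finite + 1 \<Rightarrow> 'a::comm_monoid_add"
proof -
  have "(UNIV :: 1 set) = {1}" by auto
  then show ?thesis by (simp add: UNIV_Plus_UNIV[symmetric] sum.Plus del: UNIV_Plus_UNIV)
qed

lemma vsnoc_nth [simp]: "vsnoc v a $ Inl k = v $ k" "vsnoc v a $ Inr i = a"
  by (simp_all add: vsnoc_def)

lemma vinit_vsnoc [simp]: "vinit (vsnoc v a) = v"
  by (simp add: vinit_def vec_eq_iff)

lemma vlast_vsnoc [simp]: "vlast (vsnoc v a) = a"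
  by (simp add: vlast_def)

lemma vsnoc_vinit_vlast [simp]: "vsnoc (vinit v) (vlast v) = v"
proof (rule vec_eq_iff[THEN iffD2], rule allI)
  fix i show "vsnoc (vinit v) (vlast v) $ i = v $ i"
    by (cases i) (auto simp: vinit_def vlast_def num1_eq_iff intro!: arg_cong[of _ _ "($) v"])
qed

lemma vsnoc_eq_iff [simp]: "vsnoc v a = vsnoc w b \<longleftrightarrow> v = w \<and> a = b"
  by (metis vinit_vsnoc vlast_vsnoc)

lemma zero_vec_eq_vsnoc: "vsnoc 0 0 = (0::'a::zero ^ ('p::finite + 1))"
proof (rule vec_eq_iff[THEN iffD2], rule allI)
  fix i show "vsnoc 0 0 $ i = (0::'a ^ ('p + 1)) $ i" by (cases i) simp_all
qed

lemma inner_vsnoc [simp]: "vsnoc v a \<bullet> vsnoc w b = v \<bullet> w + a * b" for a b :: real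
  by (simp add: inner_vec_def sum_UNIV_plus_1)

lemma vsnoc_matrix_vector_mult: "vsnoc M r *v x = vsnoc (M *v x) (r \<bullet> x)" for r :: "real ^ 'p"
proof (rule vec_eq_iff[THEN iffD2], rule allI)
  fix i show "(vsnoc M r *v x) $ i = vsnoc (M *v x) (r \<bullet> x) $ i"
    by (cases i) (simp_all add: matrix_vector_mul_component)
qed

text \<open>The block shape common to \<open>Phi_inv\<close> and to the rightmost factor of
  \<open>Umat\<close>.\<close>

lemma block_diag_matrix_vector_mult:
  "vsnoc (\<chi> r. vsnoc (M $ r) 0) (vsnoc 0 b) *v vsnoc x y = vsnoc (M *v x) (b * y)" for b :: real
proof -
  have "(\<chi> r. vsnoc (M $ r) 0) *v vsnoc x y = M *v x"
    by (simp add: vec_eq_iff matrix_vector_mul_component)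
  then show ?thesis by (simp add: vsnoc_matrix_vector_mult)
qed

lemma matrix_inv_eq:
  fixes A :: "real ^ 'p ^ 'q"
  assumes "A ** B = mat 1" "B ** A = mat 1"
  shows "matrix_inv A = B"
  unfolding matrix_inv_def
proof (rule some_equality)
  fix B' assume B': "A ** B' = mat 1 \<and> B' ** A = mat 1"
  then have "B' = B' ** (A ** B)" using assms by simp
  also have "\<dots> = B" using B' by (simp add: matrix_mul_assoc)
  finally show "B' = B" .
qed (use assms in simp)

text \<open>Rows and columns are indexed by different types, such as \<open>'n + 1\<close> and
  \<open>'n option\<close>, so being square means equal cardinality. Injectivity gives a left
  inverse, full rank a right inverse, and the two coincide.\<close>

lemma matrix_inv_mult_if_injective:
  fixes A :: "real ^ 'p ^ 'q"
  assumes inj: "\<And>x. A *v x = 0 \<Longrightarrow> x = 0" and card: "CARD('p) = CARD('q)"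
  shows "matrix_inv A *v (A *v x) = x" "A *v (matrix_inv A *v y) = y"
proof -
  have "inj ((*v) A)"
    using inj matrix_left_invertible_injective matrix_left_invertible_ker by blast
  moreover from this have "surj ((*v) A)"
    using card full_rank_injective full_rank_surjective by metis
  ultimately obtain B B' where B: "B ** A = mat 1" "A ** B' = mat 1"
    using matrix_left_invertible_injective matrix_right_invertible_surjective by metis
  have "B = B ** (A ** B')" using B(2) by simp
  also have "\<dots> = B'" using B(1) by (simp add: matrix_mul_assoc)
  finally have "B = B'" .
  then have "matrix_inv A = B" "A ** B = mat 1" using B by (auto intro: matrix_inv_eq)
  then show "matrix_inv A *v (A *v x) = x" "A *v (matrix_inv A *v y) = y"
    using B by (simp_all add: matrix_vector_mul_assoc)
qed

lemma diag_mult_nth: "(diag v *v x) $ i = v $ i * x $ i"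
  by (simp add: matrix_vector_mult_def diag_def if_distrib if_distribR sum.delta cong: if_cong)

lemma matrix_inv_diag:
  assumes "\<And>i. v $ i \<noteq> 0"
  shows "matrix_inv (diag v) = diag (\<chi> i. 1 / v $ i)"
  by (rule matrix_inv_eq)
     (use assms in \<open>auto simp: matrix_eq matrix_vector_mul_assoc[symmetric] vec_eq_iff diag_mult_nth\<close>)

section \<open>The transformation of the fluxes\<close>

lemma Gamma_ext_mult:
  assumes "\<And>k. L $ k > 0"
  shows "Gamma_ext L *v \<phi> = vsnoc (Gamma_T L *v \<phi>) (L_par L UNIV * (\<Sum>k\<in>UNIV. \<phi> $ k / L $ k))"
proof -
  have "L $ k \<noteq> 0" for k using assms[of k] by simp
  then have "(1 v* matrix_inv (diag L)) = (\<chi> k. 1 / L $ k)"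
    by (subst matrix_inv_diag) (simp_all add: vector_matrix_mult_def diag_def vec_eq_iff if_distrib sum.delta cong: if_cong)
  then show ?thesis
    by (simp add: Gamma_ext_def vsnoc_matrix_vector_mult inner_vec_def sum_distrib_left mult_ac)
qed

lemma Gamma_T_mult_nth:
  "(Gamma_T L *v \<phi>) $ k = L_par L {..<Some k} * (\<Sum>j\<in>{..<Some k}. \<phi> $ j / L $ j) - \<phi> $ Some k"
proof -
  have "(Gamma_T L *v \<phi>) $ k = (\<Sum>j\<in>UNIV. (if j < Some k then L_par L {..<Some k} * (\<phi> $ j / L $ j) else 0))
      - (\<Sum>j\<in>UNIV. if j = Some k then \<phi> $ j else 0)"
    unfolding sum_subtractf[symmetric]
    by (auto simp: matrix_vector_mult_def Gamma_T_def Gmat_def intro!: sum.cong)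
  also have "(\<Sum>j\<in>UNIV. (if j < Some k then L_par L {..<Some k} * (\<phi> $ j / L $ j) else 0))
     = (\<Sum>j\<in>{..<Some k}. L_par L {..<Some k} * (\<phi> $ j / L $ j))"
    by (rule sum.mono_neutral_cong_right) auto
  finally show ?thesis by (simp add: sum_distrib_left)
qed

lemma L_par_pos: "(\<And>k. L $ k > 0) \<Longrightarrow> S \<noteq> {} \<Longrightarrow> L_par L S > 0"
  unfolding L_par_def by (intro divide_pos_pos sum_pos) auto

lemma L_par_sum: "(\<And>k. L $ k > 0) \<Longrightarrow> S \<noteq> {} \<Longrightarrow> L_par L S * (\<Sum>j\<in>S. 1 / L $ j) = 1"
  using L_par_pos[of L S] unfolding L_par_def by simp

text \<open>The weights in each row of \<open>Gmat\<close> add up to \<open>1\<close>. This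
  decouples \<open>\<C>\<close> from \<open>Q\<close>: the charge enters every flux equation through
  the same term, that is, through a multiple of the vector \<open>1\<close>.\<close>

lemma Gamma_T_one:
  assumes "\<And>k. L $ k > 0"
  shows "Gamma_T L *v 1 = 0"
proof -
  have "{..<Some k} \<noteq> {}" for k :: 'a by (auto intro: less_option_None_Some)
  then show ?thesis by (simp add: vec_eq_iff Gamma_T_mult_nth L_par_sum[OF assms])
qed

text \<open>On the kernel of \<open>Gamma_T\<close>, each flux is a weighted mean of the preceding ones, so that all
  of them coincide.\<close>

lemma Gamma_ext_injective:
  fixes L :: "'n::{finite,linorder} option rvec"
  assumes L: "\<And>k. L $ k > 0" and zero: "Gamma_ext L *v \<phi> = 0"
  shows "\<phi> = 0"
proof -
  have "vsnoc (Gamma_T L *v \<phi>) (L_par L UNIV * (\<Sum>k\<in>UNIV. \<phi> $ k / L $ k)) = vsnoc 0 0"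
    using zero unfolding Gamma_ext_mult[OF L] by (metis zero_vec_eq_vsnoc)
  then have \<Gamma>: "Gamma_T L *v \<phi> = 0" and \<tau>: "L_par L UNIV * (\<Sum>k\<in>UNIV. \<phi> $ k / L $ k) = 0" by simp_all
  have eq: "\<phi> $ i = \<phi> $ None" for i
  \<comment> \<open>Counting smaller indices gives strong induction along the finite order of
    \<open>'n option\<close>, with \<open>None\<close> as the least index.\<close>
  proof (induction i rule: measure_induct_rule[of "\<lambda>i. card {..<i}"])
    case (less i)
    show ?case
    proof (cases i)
      case (Some k)
      have ne: "{..<Some k} \<noteq> {}" by (auto intro: less_option_None_Some)
      have IH: "\<phi> $ j = \<phi> $ None" if "j \<in> {..<Some k}" for j
        using that Some by (intro less psubset_card_mono) auto
      have "(Gamma_T L *v \<phi>) $ k = 0" using \<Gamma> by simp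
      then have "\<phi> $ Some k = L_par L {..<Some k} * (\<Sum>j\<in>{..<Some k}. \<phi> $ j / L $ j)"
        unfolding Gamma_T_mult_nth by simp
      also have "(\<Sum>j\<in>{..<Some k}. \<phi> $ j / L $ j) = \<phi> $ None * (\<Sum>j\<in>{..<Some k}. 1 / L $ j)"
        unfolding sum_distrib_left
      proof (rule sum.cong[OF refl])
        fix j assume "j \<in> {..<Some k}"
        from IH[OF this] show "\<phi> $ j / L $ j = \<phi> $ None * (1 / L $ j)" by simp
      qed
      also have "L_par L {..<Some k} * \<dots> = \<phi> $ None"
        using L_par_sum[OF L ne] by (simp add: mult.left_commute[of _ "\<phi> $ None"])
      finally show ?thesis using Some by simp
    qed simp
  qed
  \<comment> \<open>The last row is a weighted mean over all branches, so its vanishing makes the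
    common value \<open>0\<close>.\<close>
  have "(\<Sum>k\<in>UNIV. \<phi> $ k / L $ k) = \<phi> $ None * (\<Sum>k\<in>UNIV. 1 / L $ k)"
    unfolding sum_distrib_left
  proof (rule sum.cong[OF refl])
    fix j show "\<phi> $ j / L $ j = \<phi> $ None * (1 / L $ j)" using eq[of j] by simp
  qed
  then have "\<phi> $ None = 0"
    using \<tau> L_par_sum[OF L, of UNIV] by (simp add: mult.left_commute[of _ "\<phi> $ None"])
  then have "\<phi> $ i = 0" for i using eq[of i] by simp
  then show ?thesis by (simp add: vec_eq_iff)
qed

lemma Gamma_ext_inv:
  assumes "\<And>k. L $ k > 0"
  shows "matrix_inv (Gamma_ext L) *v (Gamma_ext L *v \<phi>) = \<phi>" "Gamma_ext L *v (matrix_inv (Gamma_ext L) *v z) = z"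
  by (rule matrix_inv_mult_if_injective; use Gamma_ext_injective[OF assms] in \<open>simp add: card_option\<close>)+

lemma Phi_inv_mult:
  assumes "\<And>k. L $ k > 0"
  shows "Phi_inv L *v vsnoc \<phi> Q
    = vsnoc (vsnoc (Gamma_T L *v \<phi>) (L_par L UNIV * (\<Sum>k\<in>UNIV. \<phi> $ k / L $ k))) Q"
  unfolding Phi_inv_def block_diag_matrix_vector_mult Gamma_ext_mult[OF assms] by simp

text \<open>\<open>Phi\<close> need not be computed: on images under \<open>Phi_inv\<close> it
  simply undoes the transformation. This is what identifies \<open>J\<close> on states with charge
  \<open>Qr\<close> with \<open>Jz\<close>.\<close>

lemma Phi_mult:
  assumes L: "\<And>k. L $ k > 0"
  shows "Phi L *v vsnoc (Gamma_ext L *v \<phi>) Q = vsnoc \<phi> Q"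
proof -
  have "Phi_inv L *v vsnoc \<phi> Q = vsnoc (Gamma_ext L *v \<phi>) Q" for \<phi> Q
    unfolding Phi_inv_def block_diag_matrix_vector_mult by simp
  moreover have "matrix_inv (Phi_inv L) *v (Phi_inv L *v vsnoc \<phi> Q) = vsnoc \<phi> Q"
  proof (rule matrix_inv_mult_if_injective)
    fix x assume "Phi_inv L *v x = 0"
    then have "Phi_inv L *v vsnoc (vinit x) (vlast x) = vsnoc 0 0" by (simp add: zero_vec_eq_vsnoc)
    then have "Gamma_ext L *v vinit x = 0" "vlast x = 0"
      unfolding Phi_inv_def block_diag_matrix_vector_mult by simp_all
    then have "vsnoc (vinit x) (vlast x) = vsnoc 0 0" using Gamma_ext_injective[OF L] by simp
    then show "x = 0" by (simp add: zero_vec_eq_vsnoc)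
  qed (simp add: card_option)
  ultimately show ?thesis by (simp add: Phi_def)
qed

text \<open>The purpose of \<open>Umat\<close>: after the flux transformation the input acts as
  \<open>diag Et\<close> applied to \<open>lam\<close> on \<open>\<C>\<close> and as
  \<open>Eeq mu\<close> on \<open>\<phi>\<^sub>T\<close>, without mutual interference.\<close>

lemma diag_Umat_mult:
  assumes "\<And>k. E $ k > 0"
  shows "diag E *v (Umat L E Et Eeq *v vsnoc lam mu) = matrix_inv (Gamma_ext L) *v vsnoc (diag Et *v lam) (Eeq * mu)"
proof -
  have "E $ k \<noteq> 0" for k using assms[of k] by simp
  then have "diag E *v (matrix_inv (diag E) *v y) = y" for y
    by (simp add: matrix_inv_diag vec_eq_iff diag_mult_nth)
  then show ?thesis
    by (simp add: Umat_def matrix_vector_mul_assoc[symmetric] block_diag_matrix_vector_mult)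
qed

section \<open>The closed loop\<close>

lemma grad_eq: "GDERIV f x :> D \<Longrightarrow> grad f x = D"
  unfolding grad_def gderiv_def
proof (rule the_equality)
  fix D' assume "(f has_derivative (\<lambda>h. h \<bullet> D)) (at x)" "(f has_derivative (\<lambda>h. h \<bullet> D')) (at x)"
  from has_derivative_unique[OF this] show "D' = D"
    by (metis vector_eq_ldot)
qed

text \<open>Evaluating the total derivative at the vectors \<open>(b, 0)\<close> gives the
  coordinates of the partial gradient. Joint continuity is needed because the second argument moves
  along trajectories too.\<close>

lemma partial_gradient:
  fixes f :: "'a::euclidean_space \<times> 'b::real_normed_vector \<Rightarrow> real"
  assumes "continuously_differentiable f"
  shows "GDERIV (\<lambda>c. f (c, p)) c :> grad (\<lambda>c. f (c, p)) c"
    and "continuous_on UNIV (\<lambda>(c, p). grad (\<lambda>c. f (c, p)) c)"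
proof -
  obtain f' where f': "\<And>x. (f has_derivative blinfun_apply (f' x)) (at x)" and cont: "continuous_on UNIV f'"
    using assms unfolding continuously_differentiable_def by blast
  define g where "g x = (\<Sum>b\<in>Basis. blinfun_apply (f' x) (b, 0) *\<^sub>R b)" for x
  have g: "GDERIV (\<lambda>c. f (c, p)) c :> g (c, p)" for c p
  proof -
    have "((\<lambda>c. (c, p)) has_derivative (\<lambda>h. (h, 0))) (at c)" by (auto intro!: derivative_eq_intros)
    from has_derivative_compose[OF this f']
    have "((\<lambda>c. f (c, p)) has_derivative (\<lambda>h. blinfun_apply (f' (c, p)) (h, 0))) (at c)" .
    moreover have "blinfun_apply (f' (c, p)) (h, 0) = h \<bullet> g (c, p)" for h
    proof -
      have lin: "linear (\<lambda>h. blinfun_apply (f' (c, p)) (h, 0))"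
      proof
        fix x y :: 'a and r :: real
        show "blinfun_apply (f' (c, p)) (x + y, 0)
            = blinfun_apply (f' (c, p)) (x, 0) + blinfun_apply (f' (c, p)) (y, 0)"
          using blinfun.add_right[of "f' (c, p)" "(x, 0)" "(y, 0)"] by simp
        show "blinfun_apply (f' (c, p)) (r *\<^sub>R x, 0) = r *\<^sub>R blinfun_apply (f' (c, p)) (x, 0)"
          using blinfun.scaleR_right[of "f' (c, p)" r "(x, 0)"] by simp
      qed
      have "blinfun_apply (f' (c, p)) (h, 0) = blinfun_apply (f' (c, p)) ((\<Sum>b\<in>Basis. (h \<bullet> b) *\<^sub>R b), 0)"
        by (simp add: euclidean_representation)
      also have "\<dots> = (\<Sum>b\<in>Basis. (h \<bullet> b) * blinfun_apply (f' (c, p)) (b, 0))"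
        unfolding linear_sum[OF lin] linear_cmul[OF lin] by simp
      finally show ?thesis by (simp add: g_def inner_sum_right mult.commute)
    qed
    ultimately show ?thesis by (simp add: gderiv_def)
  qed
  show "GDERIV (\<lambda>c. f (c, p)) c :> grad (\<lambda>c. f (c, p)) c" using g grad_eq by metis
  have "continuous_on UNIV g" unfolding g_def by (intro continuous_intros cont)
  moreover have "(\<lambda>(c, p). grad (\<lambda>c. f (c, p)) c) = g" using grad_eq[OF g] by auto
  ultimately show "continuous_on UNIV (\<lambda>(c, p). grad (\<lambda>c. f (c, p)) c)" by simp
qed

text \<open>Near \<open>0\<close> the slope is below \<open>\<bar>d\<bar> + 1\<close>; on
  \<open>[\<delta>, r]\<close> monotonicity gives
  \<open>G s \<le> G r \<le> (G r / \<delta>) s\<close>. This produces the factor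
  \<open>norm u\<close> in \<open>H_bound\<close>, on which integrability rests.\<close>

lemma mono_differentiable_linear_bound:
  fixes G :: "real \<Rightarrow> real"
  assumes mono: "strict_mono_on {0..} G" and G0: "G 0 = 0"
    and diff: "G differentiable (at 0 within {0..})" and r: "0 < r"
  shows "\<exists>\<kappa>\<ge>0. \<forall>s\<in>{0..r}. G s \<le> \<kappa> * s"
proof -
  obtain d where "(G has_real_derivative d) (at 0 within {0..})"
    using diff real_differentiable_def by blast
  then have "((\<lambda>y. G y / y) \<longlongrightarrow> d) (at 0 within {0..})"
    by (simp add: has_field_derivative_iff G0)
  then have "\<forall>\<^sub>F y in at 0 within {0..}. G y / y < \<bar>d\<bar> + 1"
    by (rule order_tendstoD) simp
  then obtain \<delta> where \<delta>: "0 < \<delta>" "\<And>y. 0 < y \<Longrightarrow> y < \<delta> \<Longrightarrow> G y / y < \<bar>d\<bar> + 1"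
    unfolding eventually_at by (force simp: dist_real_def)
  define \<kappa> where "\<kappa> = max (\<bar>d\<bar> + 1) (G r / \<delta>)"
  have le: "G s \<le> G r" if "s \<in> {0..r}" for s
    using strict_mono_on_leD[OF mono, of s r] that r by auto
  have Gr: "0 \<le> G r" using le[of 0] r G0 by auto
  show ?thesis
  proof (intro exI[of _ \<kappa>] conjI ballI)
    show "0 \<le> \<kappa>" by (simp add: \<kappa>_def le_max_iff_disj)
    fix s assume s: "s \<in> {0..r}"
    consider "s = 0" | "0 < s" "s < \<delta>" | "0 < s" "\<delta> \<le> s" using s by fastforce
    then show "G s \<le> \<kappa> * s"
    proof cases
      case 2
      then have "G s \<le> (\<bar>d\<bar> + 1) * s" using \<delta>(2)[of s] by (simp add: pos_divide_less_eq)
      also have "\<dots> \<le> \<kappa> * s" using 2 by (intro mult_right_mono) (auto simp: \<kappa>_def)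
      finally show ?thesis .
    next
      case 3
      have "G s \<le> G r / \<delta> * \<delta>" using le[OF s] \<delta> by simp
      also have "\<dots> \<le> G r / \<delta> * s" using 3 \<delta> Gr by (intro mult_left_mono) auto
      also have "\<dots> \<le> \<kappa> * s" using 3 by (intro mult_right_mono) (auto simp: \<kappa>_def)
      finally show ?thesis .
    qed (simp add: G0)
  qed
qed

text \<open>Inside the ball of radius \<open>c\<close> the left side is bounded by compactness and
  absorbed by the \<open>1\<close> next to \<open>W v\<close>. Outside,
  \<open>1 \<le> norm v / c\<close> absorbs the additional \<open>1\<close> on the left.\<close>

lemma gradient_growth_everywhere:
  fixes W :: "'a::euclidean_space \<Rightarrow> real" and g :: "'a \<Rightarrow> 'a"
  assumes cont: "continuous_on UNIV g" and W: "\<And>v. 0 \<le> W v" and "0 < c" "0 < k"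
    and far: "\<And>v. c < norm v \<Longrightarrow> norm (g v) * norm v \<le> k * W v"
  shows "\<exists>k\<ge>0. \<forall>v. norm (g v) * (1 + norm v) \<le> k * (W v + 1)"
proof -
  obtain M where M: "0 \<le> M" "\<And>v. norm v \<le> c \<Longrightarrow> norm (g v) \<le> M"
    using continuous_bounded_on_cball[OF cont] by blast
  define k' where "k' = max (M * (1 + c)) ((1 / c + 1) * k)"
  have k': "0 \<le> k'" using M \<open>0 < c\<close> by (simp add: k'_def le_max_iff_disj)
  have "norm (g v) * (1 + norm v) \<le> k' * (W v + 1)" for v
  proof (cases "norm v \<le> c")
    case True
    then have "norm (g v) * (1 + norm v) \<le> M * (1 + c)" using M by (intro mult_mono) auto
    also have "\<dots> \<le> k' * 1" by (simp add: k'_def)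
    also have "\<dots> \<le> k' * (W v + 1)" using k' W by (intro mult_left_mono) auto
    finally show ?thesis .
  next
    case False
    then have "1 \<le> norm v / c" using \<open>0 < c\<close> by (simp add: pos_le_divide_eq)
    then have "norm (g v) * (1 + norm v) \<le> norm (g v) * (norm v / c + norm v)"
      by (intro mult_left_mono) auto
    also have "\<dots> = (1 / c + 1) * (norm (g v) * norm v)" by (simp add: algebra_simps)
    also have "\<dots> \<le> (1 / c + 1) * (k * W v)" using False far \<open>0 < c\<close> by (intro mult_left_mono) auto
    also have "\<dots> = (1 / c + 1) * k * W v" by simp
    also have "\<dots> \<le> k' * (W v + 1)" using k' W[of v] by (intro mult_mono) (auto simp: k'_def)
    finally show ?thesis .
  qed
  then show ?thesis using k' by blast
qed

lemma strictly_convex_above_minimum: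
  assumes sc: "strictly_convex f" and min: "\<And>x. f m \<le> f x" and "x \<noteq> m"
  shows "f m < f x"
proof -
  have "f m \<le> f ((1 - 1/2) *\<^sub>R m + (1/2) *\<^sub>R x)" by (rule min)
  also have "\<dots> < (1 - 1/2) * f m + (1/2) * f x"
    using sc \<open>x \<noteq> m\<close> unfolding strictly_convex_def by (metis half_gt_zero_iff field_sum_of_halves less_add_same_cancel1 zero_less_one)
  finally show ?thesis by simp
qed

lemma strictly_convex_scaled:
  assumes sc: "strictly_convex f" and t: "0 \<le> t" "t \<le> 1"
  shows "f (t *\<^sub>R v + m) - f m \<le> t * (f (v + m) - f m)"
proof (cases "t = 0 \<or> t = 1 \<or> v = 0")
  case False
  then have "f ((1 - t) *\<^sub>R m + t *\<^sub>R (v + m)) < (1 - t) * f m + t * f (v + m)"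
    using sc t unfolding strictly_convex_def by (metis add_cancel_left_left order_le_less)
  moreover have "(1 - t) *\<^sub>R m + t *\<^sub>R (v + m) = t *\<^sub>R v + m" by (simp add: algebra_simps)
  ultimately show ?thesis by (simp add: algebra_simps)
qed auto

theorem theorem2:
  fixes L E :: "'n::{finite,linorder} option rvec"
    and C Qr R Eeq kd ki :: real
    and Et :: "'n rvec"
    and K :: "('n, 'n) rmat"
    and J :: "('n option + 1) rvec \<Rightarrow> real"
  assumes "\<And>k. L $ k > 0" and "\<And>k. E $ k > 0" and "C > 0" and "Qr > 0" and "R > 0"
    and "\<And>k. Et $ k > 0" and "Eeq > 0"
    and A_smooth: "continuously_differentiable (Jz J L Qr)"
    and A_convex: "\<And>\<phi>T. \<phi>T > 0 \<Longrightarrow> strictly_convex (\<lambda>\<C>. Jz J L Qr (\<C>, \<phi>T))"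
    and A_min: "\<And>\<phi>T. \<phi>T > 0 \<Longrightarrow> \<exists>\<C>. is_arg_min (\<lambda>\<C>. Jz J L Qr (\<C>, \<phi>T)) (\<lambda>_. True) \<C>"
    and F1: "\<exists>G1 G2 :: real \<Rightarrow> real.
          strict_mono_on {0..} G1 \<and> strict_mono_on {0..} G2 \<and>
          G1 0 = 0 \<and> G2 0 = 0 \<and>
          G1 differentiable (at 0 within {0..}) \<and> G2 differentiable (at 0 within {0..}) \<and>
          (\<forall>c p. norm (h_fun J L C Qr R c p) \<le> G1 \<bar>p\<bar> + G2 \<bar>p\<bar> * norm c)"
    and F2: "\<exists>c>0. \<exists>k>0. \<forall>v. norm v > c \<longrightarrow>
          norm (grad (W_fun J L C Qr R) v) * norm v \<le> k * W_fun J L C Qr R v"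
    and "transpose K = K" and "positive_definite K" and "kd > 0" and "ki > 0"
  shows "\<exists>\<phi> Q \<xi>.
      {s. closed_loop J L E C Qr R Et Eeq K kd ki s = 0} = {(\<phi>, Q, \<xi>)} \<and>
      globally_asymptotically_stable (closed_loop J L E C Qr R Et Eeq K kd ki) (\<phi>, Q, \<xi>) \<and>
      {x. is_arg_min (\<lambda>(\<phi>, Q). J (vsnoc \<phi> Q)) (feasible L E C Qr R) x} = {(\<phi>, Q)}"
proof -
  define Leq where "Leq = L_par L UNIV"
  define \<Gamma> where "\<Gamma> \<phi> = Gamma_T L *v \<phi>" for \<phi>
  define \<tau> where "\<tau> \<phi> = Leq * (\<Sum>k\<in>UNIV. \<phi> $ k / L $ k)" for \<phi> :: "'n option rvec"
  define Gi where "Gi = matrix_inv (Gamma_ext L)"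
  define ps where "ps = phiT_star L C Qr R"
  define cs where "cs = C_star J L Qr ps"
  define g where "g c p = grad_Jz J L Qr c p" for c p
  define W where "W = W_fun J L C Qr R"
  define gW where "gW v = g (v + cs) ps" for v
  \<comment> \<open>In centred coordinates \<open>u = (\<sigma>, q, x)\<close>, the deviation of
    \<open>\<phi>\<^sub>T\<close> is \<open>Leq (\<sigma> - x)\<close>, by the definition of
    \<open>\<sigma>\<close>.\<close>
  define H where "H v u = h_fun J L C Qr R v (Leq * (fst u - snd (snd u)))" for v and u :: "real \<times> real \<times> real"
  define A where "A = (\<lambda>(\<sigma>, q, x). ((- q / C - kd * \<sigma>) / Leq, \<sigma> - x - 1 / (R * C) * q, ki * q / C))"
  define CL where "CL = closed_loop J L E C Qr R Et Eeq K kd ki"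
  have L: "L $ k > 0" for k by fact
  have Leq: "0 < Leq" unfolding Leq_def by (rule L_par_pos) (auto simp: L)
  have ps: "0 < ps" using assms Leq by (simp add: ps_def phiT_star_def Leq_def)
  have ps_Leq: "ps / Leq = Qr / (R * C)" using Leq by (simp add: ps_def phiT_star_def Leq_def)
  have ext: "Gamma_ext L *v \<phi> = vsnoc (\<Gamma> \<phi>) (\<tau> \<phi>)" for \<phi>
    using Gamma_ext_mult[OF L] by (simp add: \<Gamma>_def \<tau>_def Leq_def)
  have Gi: "Gi *v vsnoc (\<Gamma> \<phi>) (\<tau> \<phi>) = \<phi>" "vsnoc (\<Gamma> (Gi *v z)) (\<tau> (Gi *v z)) = z" for \<phi> z
    using Gamma_ext_inv[OF L] by (simp_all add: Gi_def ext[symmetric])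
  then have \<Gamma>\<tau>_Gi: "\<Gamma> (Gi *v vsnoc v t) = v" "\<tau> (Gi *v vsnoc v t) = t" for v t
    by (metis vsnoc_eq_iff)+
  have inj: "\<phi> = \<psi>" if "\<Gamma> \<phi> = \<Gamma> \<psi>" "\<tau> \<phi> = \<tau> \<psi>" for \<phi> \<psi> using Gi(1) that by metis
  have \<Gamma>_add: "\<Gamma> (x + y) = \<Gamma> x + \<Gamma> y" "\<Gamma> (r *\<^sub>R x) = r *\<^sub>R \<Gamma> x" for x y r
    by (simp_all add: \<Gamma>_def matrix_vector_right_distrib matrix_vector_mult_scaleR)
  have \<tau>_add: "\<tau> (x + y) = \<tau> x + \<tau> y" "\<tau> (r *\<^sub>R x) = r * \<tau> x" for x y r
    by (simp_all add: \<tau>_def add_divide_distrib sum.distrib sum_distrib_left algebra_simps)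
  have \<Gamma>_one: "\<Gamma> 1 = 0" using Gamma_T_one[OF L] by (simp add: \<Gamma>_def)
  have \<tau>_one: "\<tau> 1 = 1" using L_par_sum[OF L, of UNIV] by (simp add: \<tau>_def Leq_def)

  have Jz: "J (vsnoc \<phi> Qr) = Jz J L Qr (\<Gamma> \<phi>, \<tau> \<phi>)" for \<phi>
    using Phi_mult[OF L, of \<phi> Qr] by (simp add: Jz_def ext)
  have cs_min: "Jz J L Qr (cs, ps) \<le> Jz J L Qr (c, ps)" for c
  proof -
    have "is_arg_min (\<lambda>\<C>. Jz J L Qr (\<C>, ps)) (\<lambda>_. True) cs"
      unfolding cs_def C_star_def arg_min_def using someI_ex[OF A_min[OF ps]] .
    then show ?thesis by (simp add: is_arg_min_linorder)
  qed
  have cs_strict: "Jz J L Qr (cs, ps) < Jz J L Qr (c, ps)" if "c \<noteq> cs" for c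
    using strictly_convex_above_minimum[OF A_convex[OF ps], of cs c] cs_min that by simp

  have W_eq: "W v = Jz J L Qr (v + cs, ps) - Jz J L Qr (cs, ps)" for v
    by (simp add: W_def W_fun_def ps_def cs_def Let_def)
  have g_deriv: "GDERIV (\<lambda>c. Jz J L Qr (c, p)) c :> g c p" for c p
    using partial_gradient(1)[OF A_smooth] by (simp add: g_def grad_Jz_def)
  have g_cont: "continuous_on UNIV (\<lambda>(c, p). g c p)"
    using partial_gradient(2)[OF A_smooth] by (simp add: g_def grad_Jz_def)
  have W_deriv: "GDERIV W v :> gW v" for v
  proof -
    have "((\<lambda>v. v + cs) has_derivative (\<lambda>h. h)) (at v)" by (auto intro!: derivative_eq_intros)
    moreover have "((\<lambda>c. Jz J L Qr (c, ps)) has_derivative (\<lambda>h. h \<bullet> gW v)) (at (v + cs))"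
      using g_deriv by (simp add: gderiv_def gW_def)
    ultimately have "((\<lambda>v. Jz J L Qr (v + cs, ps)) has_derivative (\<lambda>h. h \<bullet> gW v)) (at v)"
      by (rule has_derivative_compose)
    then have "(W has_derivative (\<lambda>h. h \<bullet> gW v)) (at v)"
      unfolding W_eq[abs_def] by (auto intro!: derivative_eq_intros)
    then show ?thesis by (simp add: gderiv_def)
  qed
  have g_compose: "continuous_on UNIV (\<lambda>x. g (f x) (p x))" if "continuous_on UNIV f" "continuous_on UNIV p" for f p
    using continuous_on_compose2[OF g_cont continuous_on_Pair[OF that]] by simp
  have gW_cont: "continuous_on UNIV gW"
    unfolding gW_def[abs_def] by (intro g_compose continuous_intros)
  have h_eq: "h_fun J L C Qr R v p = g (v + cs) (p + ps) - gW v" for v p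
    by (simp add: h_fun_def Let_def g_def gW_def ps_def cs_def)
  have H_cont: "continuous_on UNIV (\<lambda>(v, u). H v u)"
    unfolding H_def h_eq case_prod_unfold gW_def by (intro continuous_intros g_compose)
  have H_bound: "\<exists>\<kappa>\<ge>0. \<forall>v u. norm u \<le> r \<longrightarrow> norm (H v u) \<le> \<kappa> * norm u * (1 + norm v)" if "0 < r" for r
  proof -
    obtain G1 G2 where G: "strict_mono_on {0..} G1" "strict_mono_on {0..} G2" "G1 0 = 0" "G2 0 = 0"
      "G1 differentiable (at 0 within {0..})" "G2 differentiable (at 0 within {0..})"
      and h: "\<And>c p. norm (h_fun J L C Qr R c p) \<le> G1 \<bar>p\<bar> + G2 \<bar>p\<bar> * norm c"
      using F1 by blast
    \<comment> \<open>Both entries of \<open>u\<close> are at most \<open>norm u\<close>, so for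
      \<open>norm u \<le> r\<close> the deviation of \<open>\<phi>\<^sub>T\<close> is at most
      \<open>Leq\<close> times \<open>2 r\<close>; this is the range on which linear bounds are
      needed.\<close>
    have "0 < Leq * (2 * r)" using Leq that by simp
    then obtain \<kappa>1 \<kappa>2 where \<kappa>: "0 \<le> \<kappa>1" "0 \<le> \<kappa>2" "\<And>s. s \<in> {0..Leq * (2 * r)} \<Longrightarrow> G1 s \<le> \<kappa>1 * s"
      "\<And>s. s \<in> {0..Leq * (2 * r)} \<Longrightarrow> G2 s \<le> \<kappa>2 * s"
      using mono_differentiable_linear_bound[OF G(1,3,5)] mono_differentiable_linear_bound[OF G(2,4,6)] by metis
    have "norm (H v u) \<le> (max \<kappa>1 \<kappa>2 * (Leq * 2)) * norm u * (1 + norm v)" if u: "norm u \<le> r" for v u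
    proof -
      define p where "p = \<bar>Leq * (fst u - snd (snd u))\<bar>"
      have "\<bar>fst u\<bar> \<le> norm u" "\<bar>snd (snd u)\<bar> \<le> norm u"
        using norm_fst_le[of "fst u" "snd u"] norm_snd_le[of "snd u" "fst u"] norm_snd_le[of "snd (snd u)" "fst (snd u)"]
        by (simp_all add: real_norm_def[symmetric] del: real_norm_def)
      then have "\<bar>fst u - snd (snd u)\<bar> \<le> 2 * norm u" by linarith
      then have p: "p \<le> Leq * (2 * norm u)" "0 \<le> p" using Leq by (auto simp: p_def abs_mult)
      have "Leq * (2 * norm u) \<le> Leq * (2 * r)" using u Leq by simp
      then have pr: "p \<in> {0..Leq * (2 * r)}" using p by simp
      have le: "\<kappa>1 * p \<le> max \<kappa>1 \<kappa>2 * p" "\<kappa>2 * p \<le> max \<kappa>1 \<kappa>2 * p"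
        using p(2) by (intro mult_right_mono; simp)+
      have "norm (H v u) \<le> G1 p + G2 p * norm v" unfolding H_def p_def by (rule h)
      also have "\<dots> \<le> max \<kappa>1 \<kappa>2 * p + max \<kappa>1 \<kappa>2 * p * norm v"
        using \<kappa>(3,4)[OF pr] le by (intro add_mono mult_right_mono) auto
      also have "\<dots> = max \<kappa>1 \<kappa>2 * p * (1 + norm v)" by (simp add: algebra_simps)
      also have "\<dots> \<le> max \<kappa>1 \<kappa>2 * (Leq * (2 * norm u)) * (1 + norm v)"
        using \<kappa>(1) p(1) by (intro mult_right_mono mult_left_mono) (auto simp: le_max_iff_disj)
      finally show ?thesis by (simp add: algebra_simps)
    qed
    moreover have "0 \<le> max \<kappa>1 \<kappa>2 * (Leq * 2)" using \<kappa>(1) Leq by (simp add: le_max_iff_disj)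
    ultimately show ?thesis by blast
  qed
  have W_pos: "0 < W v" if "v \<noteq> 0" for v using cs_strict[of "v + cs"] that by (simp add: W_eq)
  have W_zero: "W 0 = 0" by (simp add: W_eq)
  have W_nonneg: "0 \<le> W v" for v using W_pos[of v] W_zero by (cases "v = 0") auto
  have W_growth: "\<exists>k\<ge>0. \<forall>v. norm (gW v) * (1 + norm v) \<le> k * (W v + 1)"
  proof -
    obtain c k where "0 < c" "0 < k" "\<And>v. c < norm v \<Longrightarrow> norm (gW v) * norm v \<le> k * W v"
      using F2 grad_eq[OF W_deriv] unfolding W_def by metis
    then show ?thesis by (rule gradient_growth_everywhere[OF gW_cont W_nonneg])
  qed
  have A_linear: "bounded_linear A"
    unfolding A_def case_prod_unfold linear_conv_bounded_linear[symmetric]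
    by (rule linearI) (simp_all add: algebra_simps add_divide_distrib diff_divide_distrib)
  obtain c \<alpha> where c: "0 < c" "0 < \<alpha>" "\<And>T u t. 0 < T \<Longrightarrow> solves_on A {0..<T} u \<Longrightarrow>
      t \<in> {0..<T} \<Longrightarrow> norm (u t) \<le> c * exp (- \<alpha> * t) * norm (u 0)"
    using linear_block_decay[of Leq C "1 / (R * C)" kd ki] Leq assms unfolding A_def by auto
  interpret cascade W gW H "(*v) K" A c \<alpha>
  proof (rule cascade.intro)
    show "bounded_linear ((*v) K)" by simp
    show "0 < v \<bullet> (K *v v)" if "v \<noteq> 0" for v
      using \<open>positive_definite K\<close> that by (simp add: positive_definite_def)
    show "W (t *\<^sub>R v) \<le> t * W v" if "0 \<le> t" "t \<le> 1" for t v
      using strictly_convex_scaled[OF A_convex[OF ps] that, of v cs] by (simp add: W_eq)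
  qed (fact W_deriv gW_cont H_cont A_linear W_zero W_pos W_growth H_bound c)+

  \<comment> \<open>At rest \<open>Q = Qr\<close>, and \<open>Eeq mu = - kd \<sigma>s\<close> has to
    balance the common voltage \<open>Qr / C\<close>. The value \<open>\<xi>s\<close> then follows
    from the definition of \<open>\<sigma>\<close>.\<close>
  define \<sigma>s where "\<sigma>s = - Qr / (C * kd)"
  define \<phi>s where "\<phi>s = Gi *v vsnoc cs ps"
  define \<xi>s where "\<xi>s = \<sigma>s - ps / Leq"
  \<comment> \<open>\<open>B\<close> passes to the coordinates of the cascade, and \<open>B'\<close>
    recovers \<open>\<phi>\<^sub>T\<close> as \<open>Leq (\<sigma> - \<xi>)\<close>. Both are
    linear; the centring is the translation that appears in \<open>conj\<close>.\<close>
  define B where "B = (\<lambda>(\<phi>, Q, \<xi>). (\<Gamma> \<phi>, \<tau> \<phi> / Leq + \<xi>, Q :: real, \<xi> :: real))"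
  define B' where "B' = (\<lambda>(v, \<sigma>, q :: real, x). (Gi *v vsnoc v (Leq * (\<sigma> - x)), q, x :: real))"
  have \<phi>s: "\<Gamma> \<phi>s = cs" "\<tau> \<phi>s = ps" using \<Gamma>\<tau>_Gi by (simp_all add: \<phi>s_def)
  have B_linear: "linear B"
    unfolding B_def case_prod_unfold
    by (rule linearI) (simp_all add: \<Gamma>_add \<tau>_add add_divide_distrib algebra_simps prod_eq_iff)
  have B'B: "B' (B x) = x" for x
    using Leq Gi(1) by (auto simp: B_def B'_def split: prod.splits)
  have BB': "B (B' y) = y" for y
    using Leq by (auto simp: B_def B'_def \<Gamma>\<tau>_Gi split: prod.splits)
  have B'_linear: "linear B'"
  proof (rule linearI)
    fix x y r
    show "B' (x + y) = B' x + B' y" using linear_add[OF B_linear, of "B' x" "B' y"] B'B BB' by metis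
    show "B' (r *\<^sub>R x) = r *\<^sub>R B' x" using linear_scale[OF B_linear, of r "B' x"] B'B BB' by metis
  qed
  have conj: "B (CL s) = F (B (s - (\<phi>s, Qr, \<xi>s)))" for s
  proof -
    obtain \<phi> Q \<xi> where s: "s = (\<phi>, Q, \<xi>)" by (cases s)
    define mu where "mu = - (1 / Eeq) * (kd * (\<tau> \<phi> / Leq) + kd * \<xi> + Leq * ki * ((Q - Qr) / C))"
    define lam where "lam = - ((matrix_inv (diag Et) ** K) *v g (\<Gamma> \<phi>) (\<tau> \<phi>))"
    define d where "d = Umat L E Et Eeq *v vsnoc lam mu"
    define \<phi>' where "\<phi>' = (\<chi> k. - Q / C + E $ k * d $ k)"
    have fb: "feedback J L E C Qr Et Eeq K kd ki (\<phi>, Q, \<xi>) = d"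
      using Phi_inv_mult[OF L, of \<phi> Q]
      by (simp add: feedback_def Let_def d_def lam_def mu_def \<Gamma>_def \<tau>_def Leq_def g_def)
    have CLs: "CL s = (\<phi>', \<tau> \<phi> / Leq - Q / (R * C), ki * ((Q - Qr) / C))"
      using Leq by (simp add: CL_def closed_loop_def s fb plant_def Let_def \<phi>'_def integrator_def \<tau>_def)
    \<comment> \<open>The common voltage is a multiple of the vector \<open>1\<close>, which
      \<open>\<Gamma>\<close> annihilates and \<open>\<tau>\<close> maps to
      \<open>1\<close>.\<close>
    have "\<phi>' = (- Q / C) *\<^sub>R 1 + diag E *v d"
      by (simp add: \<phi>'_def vec_eq_iff diag_mult_nth)
    also have "diag E *v d = Gi *v vsnoc (diag Et *v lam) (Eeq * mu)"
      unfolding d_def Gi_def by (rule diag_Umat_mult) fact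
    finally have \<phi>': "\<Gamma> \<phi>' = diag Et *v lam" "\<tau> \<phi>' = - Q / C + Eeq * mu"
      by (simp_all only: \<Gamma>_add \<tau>_add \<Gamma>_one \<tau>_one \<Gamma>\<tau>_Gi scaleR_zero_right add_0_left mult_1_right)
    have Et: "Et $ k \<noteq> 0" for k using assms(6)[of k] by simp
    have "diag Et *v lam = - (K *v g (\<Gamma> \<phi>) (\<tau> \<phi>))"
      unfolding lam_def matrix_inv_diag[OF Et] matrix_vector_mul_assoc[symmetric] using Et
      by (simp add: vec_eq_iff diag_mult_nth)
    moreover have "g (\<Gamma> \<phi>) (\<tau> \<phi>) = gW (\<Gamma> \<phi> - cs) + h_fun J L C Qr R (\<Gamma> \<phi> - cs) (\<tau> \<phi> - ps)"
      by (simp add: h_eq)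
    ultimately have 1: "\<Gamma> \<phi>' = - (K *v (gW (\<Gamma> \<phi> - cs) + h_fun J L C Qr R (\<Gamma> \<phi> - cs) (\<tau> \<phi> - ps)))"
      using \<phi>' by simp
    have \<Gamma>_diff: "\<Gamma> (\<phi> - \<phi>s) = \<Gamma> \<phi> - cs"
      using \<Gamma>_add(1)[of "\<phi> - \<phi>s" \<phi>s] \<phi>s by simp
    have \<tau>_diff: "\<tau> (\<phi> - \<phi>s) = \<tau> \<phi> - ps"
      using \<tau>_add(1)[of "\<phi> - \<phi>s" \<phi>s] \<phi>s by simp
    define \<sigma> where "\<sigma> = (\<tau> \<phi> - ps) / Leq + (\<xi> - \<xi>s)"
    have \<sigma>: "\<tau> \<phi> / Leq + \<xi> = \<sigma> + \<sigma>s" by (simp add: \<sigma>_def \<xi>s_def diff_divide_distrib)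
    have B_s: "B (s - (\<phi>s, Qr, \<xi>s)) = (\<Gamma> \<phi> - cs, \<sigma>, Q - Qr, \<xi> - \<xi>s)"
      by (simp add: s B_def \<Gamma>_diff \<tau>_diff \<sigma>_def)
    have "Eeq * mu = - (kd * (\<tau> \<phi> / Leq) + kd * \<xi> + Leq * ki * ((Q - Qr) / C))"
      using \<open>Eeq > 0\<close> by (simp add: mu_def)
    also have "\<dots> = - (kd * (\<sigma> + \<sigma>s) + Leq * ki * ((Q - Qr) / C))"
      by (simp only: \<sigma>[symmetric] distrib_left)
    finally have mu: "Eeq * mu = - (kd * (\<sigma> + \<sigma>s) + Leq * ki * ((Q - Qr) / C))" .
    have kd\<sigma>s: "kd * \<sigma>s = - Qr / C" using \<open>kd > 0\<close> by (simp add: \<sigma>s_def)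
    have "\<tau> \<phi>' = - (Q - Qr) / C - kd * \<sigma> - Leq * ki * ((Q - Qr) / C)"
      unfolding \<phi>' mu distrib_left kd\<sigma>s by (simp add: diff_divide_distrib)
    then have 2: "\<tau> \<phi>' / Leq + ki * ((Q - Qr) / C) = (- (Q - Qr) / C - kd * \<sigma>) / Leq"
      using Leq by (simp add: diff_divide_distrib)
    have 3: "\<tau> \<phi> / Leq - Q / (R * C) = \<sigma> - (\<xi> - \<xi>s) - 1 / (R * C) * (Q - Qr)"
      using ps_Leq by (simp add: \<sigma>_def diff_divide_distrib algebra_simps)
    have 4: "Leq * (\<sigma> - (\<xi> - \<xi>s)) = \<tau> \<phi> - ps" using Leq by (simp add: \<sigma>_def)
    have "(Qr - Q) / C = - ((Q - Qr) / C)" by (simp add: diff_divide_distrib)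
    then show ?thesis
      using 1 2 3 4 unfolding B_s CLs F_def by (simp add: B_def A_def H_def)
  qed
  have gas: "globally_asymptotically_stable CL (\<phi>s, Qr, \<xi>s)"
    using gas_affine_transport[OF _ _ B'B BB' conj F_gas] B_linear B'_linear
    by (simp add: linear_conv_bounded_linear)
  then have "CL (\<phi>s, Qr, \<xi>s) = 0" by (simp add: globally_asymptotically_stable_def)
  then have equilibrium: "{s. CL s = 0} = {(\<phi>s, Qr, \<xi>s)}"
    using gas_unique_equilibrium[OF gas] by blast

  have feasible: "feasible L E C Qr R (\<phi>, Q) \<longleftrightarrow> Q = Qr \<and> \<tau> \<phi> = ps" for \<phi> Q
  proof -
    \<comment> \<open>With \<open>E\<close> positive and \<open>d\<close> unrestricted, the flux
      equations can always be balanced; only the charge equation restricts \<open>\<phi>\<close>,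
      and it prescribes \<open>\<tau> \<phi>\<close>.\<close>
    have "\<exists>d. \<forall>k. - Q / C + E $ k * d $ k = 0"
    proof
      show "\<forall>k. - Q / C + E $ k * (\<chi> k. Q / C / E $ k) $ k = 0"
        using assms(2) by (auto simp: less_imp_neq[symmetric])
    qed
    moreover have "(\<Sum>k\<in>UNIV. \<phi> $ k / L $ k) - Qr / (R * C) = 0 \<longleftrightarrow> \<tau> \<phi> = ps"
      unfolding \<tau>_def ps_Leq[symmetric] using Leq by (simp add: eq_divide_eq mult.commute)
    ultimately show ?thesis
      by (auto simp: feasible_def plant_def zero_prod_def vec_eq_iff)
  qed
  \<comment> \<open>On the feasible set \<open>\<Gamma> \<phi>\<close> is the only free coordinate,
    and \<open>cs\<close> is the strict minimizer in it.\<close>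
  have "is_arg_min (\<lambda>(\<phi>, Q). J (vsnoc \<phi> Q)) (feasible L E C Qr R) (\<phi>, Q) \<longleftrightarrow> (\<phi>, Q) = (\<phi>s, Qr)" for \<phi> Q
  proof
    assume min: "is_arg_min (\<lambda>(\<phi>, Q). J (vsnoc \<phi> Q)) (feasible L E C Qr R) (\<phi>, Q)"
    then have Q: "Q = Qr" and \<tau>: "\<tau> \<phi> = ps" by (auto simp: is_arg_min_def feasible)
    have "feasible L E C Qr R (\<phi>s, Qr)" by (simp add: feasible \<phi>s)
    then have "\<not> J (vsnoc \<phi>s Qr) < J (vsnoc \<phi> Qr)" using min Q by (auto simp: is_arg_min_def)
    then have "\<Gamma> \<phi> = cs" using cs_strict[of "\<Gamma> \<phi>"] by (auto simp: Jz \<tau> \<phi>s)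
    then show "(\<phi>, Q) = (\<phi>s, Qr)" using inj[of \<phi> \<phi>s] \<tau> \<phi>s Q by simp
  next
    assume "(\<phi>, Q) = (\<phi>s, Qr)"
    then show "is_arg_min (\<lambda>(\<phi>, Q). J (vsnoc \<phi> Q)) (feasible L E C Qr R) (\<phi>, Q)"
      using cs_min by (auto simp: is_arg_min_def feasible \<phi>s Jz not_less)
  qed
  then have "{x. is_arg_min (\<lambda>(\<phi>, Q). J (vsnoc \<phi> Q)) (feasible L E C Qr R) x} = {(\<phi>s, Qr)}"
    by auto
  then show ?thesis using equilibrium gas unfolding CL_def by blast
qed

end
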